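(* Let $X$ be a standard Borel space and let $(\rho_n)_{n\in\mathbb{N}}$ be a sequence of Borel proper extended metrics on $X$. Assume that for every $n\in\mathbb{N}$ and $r>0$ the $\rho_n$-balls of radius $r$ have uniformly bounded (finite) $\rho_{n+1}$-diameter, and set $E=\bigcup_n E_{\rho_n}$. If $(X,\rho_n)$ has finite Borel asymptotic dimension for every $n$, then $E$ is hyperfinite.
   Context: An extended metric is a metric allowed to take the value $+\infty$. It is proper if every ball of finite radius has finite cardinality. $E_\rho=\{(x,y)\in X\times X:\rho(x,y)<\infty\}$. The Borel asymptotic dimension of $(X,\rho)$ is the least $d\in\mathbb{N}$ such that for every $r>0$ there is a Borel equivalence relation $F$ on $X$, with a finite uniform bound on the $\rho$-diameters of its classes, such that every closed $\rho$-ball of radius $r$ meets at most $d+1$ classes of $F$; it is $\infty$ if no such $d$ exists. An equivalence relation on $X$ is Borel if it is a Borel subset of $X\times X$, finite if all its classes are finite, and hyperfinite if it is the union of an increasing sequence of finite Borel equivalence relations. *)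

theory Defs
  imports "HOL-Analysis.Analysis"
begin

text \<open>
  A standard Borel space is represented by a value of type \<open>'a measure\<close> of which only the
  carrier and the sigma-algebra matter; the measure itself plays no role.  A binary relation is
  Borel if it belongs to \<open>sets (M \<Otimes>\<^sub>M M)\<close>.
\<close>

definition standard_borel :: "'a measure \<Rightarrow> bool" where
  "standard_borel M \<longleftrightarrow>
     (\<exists>T. topspace T = space M \<and> completely_metrizable_space T \<and> second_countable T \<and>
          sets M = sigma_sets (space M) {U. openin T U})"

definition extended_metric_on :: "'a set \<Rightarrow> ('a \<Rightarrow> 'a \<Rightarrow> ennreal) \<Rightarrow> bool" where
  "extended_metric_on X \<rho> \<longleftrightarrow>
     (\<forall>x\<in>X. \<forall>y\<in>X. \<rho> x y = 0 \<longleftrightarrow> x = y) \<and>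
     (\<forall>x\<in>X. \<forall>y\<in>X. \<rho> x y = \<rho> y x) \<and>
     (\<forall>x\<in>X. \<forall>y\<in>X. \<forall>z\<in>X. \<rho> x z \<le> \<rho> x y + \<rho> y z)"

definition borel_extended_metric :: "'a measure \<Rightarrow> ('a \<Rightarrow> 'a \<Rightarrow> ennreal) \<Rightarrow> bool" where
  "borel_extended_metric M \<rho> \<longleftrightarrow>
     extended_metric_on (space M) \<rho> \<and> (\<lambda>(x, y). \<rho> x y) \<in> borel_measurable (M \<Otimes>\<^sub>M M)"

definition ext_cball :: "'a set \<Rightarrow> ('a \<Rightarrow> 'a \<Rightarrow> ennreal) \<Rightarrow> 'a \<Rightarrow> real \<Rightarrow> 'a set" where
  "ext_cball X \<rho> x r = {y \<in> X. \<rho> x y \<le> ennreal r}"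

text \<open>The empty set has diameter \<open>0\<close>, the bottom element of \<^typ>\<open>ennreal\<close>.\<close>

definition ext_diameter :: "('a \<Rightarrow> 'a \<Rightarrow> ennreal) \<Rightarrow> 'a set \<Rightarrow> ennreal" where
  "ext_diameter \<rho> A = (SUP x\<in>A. SUP y\<in>A. \<rho> x y)"

definition proper_ext_metric_on :: "'a set \<Rightarrow> ('a \<Rightarrow> 'a \<Rightarrow> ennreal) \<Rightarrow> bool" where
  "proper_ext_metric_on X \<rho> \<longleftrightarrow> (\<forall>x\<in>X. \<forall>r>0. finite (ext_cball X \<rho> x r))"

definition finite_dist_rel :: "'a set \<Rightarrow> ('a \<Rightarrow> 'a \<Rightarrow> ennreal) \<Rightarrow> ('a \<times> 'a) set" where
  "finite_dist_rel X \<rho> = {(x, y) \<in> X \<times> X. \<rho> x y < \<infinity>}"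

definition borel_equiv_rel :: "'a measure \<Rightarrow> ('a \<times> 'a) set \<Rightarrow> bool" where
  "borel_equiv_rel M F \<longleftrightarrow> equiv (space M) F \<and> F \<in> sets (M \<Otimes>\<^sub>M M)"

definition finite_borel_equiv_rel :: "'a measure \<Rightarrow> ('a \<times> 'a) set \<Rightarrow> bool" where
  "finite_borel_equiv_rel M F \<longleftrightarrow>
     borel_equiv_rel M F \<and> (\<forall>C \<in> space M // F. finite C)"

definition hyperfinite :: "'a measure \<Rightarrow> ('a \<times> 'a) set \<Rightarrow> bool" where
  "hyperfinite M E \<longleftrightarrow>
     (\<exists>F :: nat \<Rightarrow> ('a \<times> 'a) set.
        (\<forall>n. finite_borel_equiv_rel M (F n)) \<and> incseq F \<and> E = (\<Union>n. F n))"

text \<open>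
  Finiteness of the set of classes met by a ball is required explicitly because \<^const>\<open>card\<close>
  of an infinite set is \<open>0\<close>.
\<close>

definition borel_asdim_le :: "'a measure \<Rightarrow> ('a \<Rightarrow> 'a \<Rightarrow> ennreal) \<Rightarrow> nat \<Rightarrow> bool" where
  "borel_asdim_le M \<rho> d \<longleftrightarrow>
     (\<forall>r::real. r > 0 \<longrightarrow>
        (\<exists>F. borel_equiv_rel M F \<and>
             (\<exists>D<\<infinity>. \<forall>C \<in> space M // F. ext_diameter \<rho> C \<le> D) \<and>
             (\<forall>x \<in> space M.
                finite {C \<in> space M // F. C \<inter> ext_cball (space M) \<rho> x r \<noteq> {}} \<and>
                card {C \<in> space M // F. C \<inter> ext_cball (space M) \<rho> x r \<noteq> {}} \<le> d + 1)))"

text \<open>The infimum in \<^typ>\<open>enat\<close> is the least element, and \<open>\<infinity>\<close> for the empty set.\<close>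

definition borel_asdim :: "'a measure \<Rightarrow> ('a \<Rightarrow> 'a \<Rightarrow> ennreal) \<Rightarrow> enat" where
  "borel_asdim M \<rho> = Inf {enat d | d. borel_asdim_le M \<rho> d}"

end

theory Submission
  imports Defs
begin

text \<open>
  For each \<open>n\<close> start with the equality relation and coarsen it successively along the metrics
  \<open>\<rho>\<^bsub>n-1\<^esub>, \<dots>, \<rho>\<^bsub>0\<^esub>\<close>, obtaining a finite Borel equivalence relation \<open>R 0 n\<close>. Coarsening along
  \<open>\<rho>\<^bsub>m\<^esub>\<close> makes the relation a union of pieces that are separated by spheres around the cells of one
  fixed uniformly bounded partition. Finite asymptotic dimension bounds the number of cells near a
  point, and by induction only boundedly many indices \<open>n\<close> separate points near a given cell. So
  these indices can be given spheres of distinct, well separated radii around that cell, from a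
  range that does not depend on \<open>n\<close>. Hence every \<open>\<rho>\<^bsub>m\<^esub>\<close>-ball of a certain radius is separated by
  the relations of only boundedly many \<open>n\<close>; the bound depends on \<open>m\<close> alone, although the
  dimensions may grow. Therefore \<open>E\<close> is the limit inferior of the relations \<open>R 0 n\<close>.

  Borelness rests on the Lusin--Novikov theorem for finite sections: balls are enumerated by
  countably many Borel functions, which turns quantifiers over balls into countable ones.
\<close>

section \<open>Analytic sets\<close>


text \<open>Constants are chosen upwards and relations are built downwards. The width
  \<open>w m\<close> and the next dimension \<open>d (Suc m)\<close> give \<open>r m\<close>; then
  comes the partition \<open>F m\<close>, whose cells are met at most \<open>d m + 1\<close> times
  by a ball of radius \<open>r m\<close>; then its diameter bound \<open>b m\<close>; and finally
  \<open>w (Suc m)\<close>, large enough to absorb all distances of level \<open>m\<close>. Letting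
  \<open>r m\<close> depend on \<open>d (Suc m)\<close> costs nothing, since the multiplicity
  \<open>d m + 1\<close> is the same at every radius. So the count at level \<open>m\<close> forgets
  the count one level up, and nothing accumulates even if the dimensions are unbounded.

  Radii indexed by \<open>n\<close> itself would grow with \<open>n\<close>, while
  \<open>F m\<close> has to be fixed before \<open>n\<close> is known. The position of
  \<open>n\<close> among the indices active at a cell stays bounded and replaces it.

  The relations \<open>R 0 n\<close> need not increase with \<open>n\<close>. Intersecting the tails
  of the sequence restores monotonicity and keeps classes finite; it exhausts \<open>E\<close> once
  each pair is separated by only finitely many of them.\<close>

instance "fun" :: (type, t0_space) t0_space
proof
  fix x y :: "'a \<Rightarrow> 'b"
  assume "x \<noteq> y"
  then obtain i where "x i \<noteq> y i" by auto
  then obtain U where "open U" "\<not> (x i \<in> U \<longleftrightarrow> y i \<in> U)" using separation_t0[of "x i" "y i"] by blast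
  moreover have "open ((\<lambda>z :: 'a \<Rightarrow> 'b. z i) -` U)" using \<open>open U\<close> by (auto intro!: open_vimage)
  ultimately show "\<exists>U. open U \<and> \<not> (x \<in> U \<longleftrightarrow> y \<in> U)"
    by (intro exI[of _ "(\<lambda>z. z i) -` U"]) auto
qed

instance "fun" :: (type, t1_space) t1_space
proof
  fix x y :: "'a \<Rightarrow> 'b"
  assume "x \<noteq> y"
  then obtain i where "x i \<noteq> y i" by auto
  from t1_space[OF this] obtain U where "open U" "x i \<in> U" "y i \<notin> U" by blast
  moreover have "open ((\<lambda>z :: 'a \<Rightarrow> 'b. z i) -` U)" using \<open>open U\<close> by (auto intro!: open_vimage)
  ultimately show "\<exists>U. open U \<and> x \<in> U \<and> y \<notin> U"
    by (intro exI[of _ "(\<lambda>z. z i) -` U"]) auto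
qed

text \<open>Baire space is the type \<open>nat \<Rightarrow> nat\<close>; this puts it and its
  square within reach of the separation theorems. The class \<open>t2_space\<close> sits above the
  classes of the two preceding instances.\<close>

instance "fun" :: (type, t2_space) t2_space
proof
  fix x y :: "'a \<Rightarrow> 'b"
  assume "x \<noteq> y"
  then obtain i where "x i \<noteq> y i" by auto
  from hausdorff[OF this] obtain U V where UV: "open U" "open V" "x i \<in> U" "y i \<in> V" "U \<inter> V = {}"
    by blast
  have "open ((\<lambda>z :: 'a \<Rightarrow> 'b. z i) -` U)" "open ((\<lambda>z :: 'a \<Rightarrow> 'b. z i) -` V)"
    using UV(1,2) by (auto intro!: open_vimage)
  then show "\<exists>U V. open U \<and> open V \<and> x \<in> U \<and> y \<in> V \<and> U \<inter> V = {}"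
    using UV(3-5) by (intro exI[of _ "(\<lambda>z. z i) -` U"] exI[of _ "(\<lambda>z. z i) -` V"]) auto
qed

text \<open>Using closed subsets of Baire space as domains makes the empty set no exception and
  allows closed conditions on codes without retracting onto them.\<close>

definition analytic :: "'b::topological_space set \<Rightarrow> bool" where
  "analytic A \<longleftrightarrow>
     (\<exists>C (g :: (nat \<Rightarrow> nat) \<Rightarrow> 'b). closed C \<and> continuous_on UNIV g \<and> A = g ` C)"

lemma analytic_image:
  assumes "continuous_on UNIV h" "analytic A"
  shows "analytic (h ` A)"
proof -
  obtain C and g :: "(nat \<Rightarrow> nat) \<Rightarrow> _"
    where "closed C" and g: "continuous_on UNIV g" and A: "A = g ` C"
    using assms(2) unfolding analytic_def by blast
  have "continuous_on UNIV (\<lambda>\<alpha>. h (g \<alpha>))"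
    using continuous_on_compose2[OF assms(1) g] by auto
  then show ?thesis
    unfolding analytic_def A image_image using \<open>closed C\<close> by blast
qed

lemma continuous_on_reindex:
  "continuous_on UNIV (\<lambda>\<alpha> :: 'i \<Rightarrow> 'b::topological_space. \<lambda>k. \<alpha> (f k))"
  by (intro continuous_on_coordinatewise_then_product continuous_on_product_coordinates)

lemma closed_vimage_UNIV:
  "closed S \<Longrightarrow> continuous_on UNIV f \<Longrightarrow> closed (f -` S)"
  using closed_vimage_Int[of S UNIV f] by auto

text \<open>The first digit of a code selects the set; the remaining digits are a code within
  it.\<close>

lemma analytic_UN:
  fixes A :: "nat \<Rightarrow> 'b::topological_space set"
  assumes "\<And>n. analytic (A n)"
  shows "analytic (\<Union>n. A n)"
proof -
  have "\<exists>C (g :: (nat \<Rightarrow> nat) \<Rightarrow> 'b). closed C \<and> continuous_on UNIV g \<and> A n = g ` C" for n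
    using assms[of n] unfolding analytic_def .
  then obtain C and g :: "nat \<Rightarrow> (nat \<Rightarrow> nat) \<Rightarrow> 'b"
    where C: "\<And>n. closed (C n)" and g: "\<And>n. continuous_on UNIV (g n)" and A: "\<And>n. A n = g n ` C n"
    by metis
  define sh :: "(nat \<Rightarrow> nat) \<Rightarrow> nat \<Rightarrow> nat" where "sh \<alpha> = (\<lambda>k. \<alpha> (Suc k))" for \<alpha>
  have sh: "continuous_on UNIV sh"
    unfolding sh_def by (rule continuous_on_reindex)
  define D where "D = {\<alpha>. sh \<alpha> \<in> C (\<alpha> 0)}"
  \<comment> \<open>The set \<open>C (\<alpha> 0)\<close> varies with the code. For each fixed
    \<open>n\<close> the condition says that the first digit differs from \<open>n\<close> or the
    tail lies in \<open>C n\<close>, and both alternatives are closed.\<close>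
  have "D = (\<Inter>n. (\<lambda>\<alpha>. \<alpha> 0) -` (- {n}) \<union> sh -` C n)"
    unfolding D_def by auto
  moreover have "closed ((\<lambda>\<alpha>::nat \<Rightarrow> nat. \<alpha> 0) -` (- {n}))" for n
    by (rule closed_vimage_UNIV) (auto simp: closed_def open_discrete)
  ultimately have "closed D"
    using closed_vimage_UNIV[OF C sh] by auto
  moreover have "continuous_on UNIV (\<lambda>\<alpha>. g (\<alpha> 0) (sh \<alpha>))"
  proof -
    define O' :: "nat \<Rightarrow> (nat \<Rightarrow> nat) set" where "O' n = (\<lambda>\<alpha>. \<alpha> 0) -` {n}" for n
    have "open (O' n)" for n
      unfolding O'_def by (rule open_vimage) (auto simp: open_discrete)
    moreover have "continuous_on (O' n) (\<lambda>\<alpha>. g (\<alpha> 0) (sh \<alpha>))" for n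
    proof -
      have "continuous_on UNIV (\<lambda>\<alpha>. g n (sh \<alpha>))"
        using continuous_on_compose2[OF g sh] by auto
      then have "continuous_on (O' n) (\<lambda>\<alpha>. g n (sh \<alpha>))"
        using continuous_on_subset by blast
      then show ?thesis
        by (rule continuous_on_eq) (auto simp: O'_def)
    qed
    ultimately have "continuous_on (\<Union>n. O' n) (\<lambda>\<alpha>. g (\<alpha> 0) (sh \<alpha>))"
      by (intro continuous_on_open_UN) auto
    moreover have "(\<Union>n. O' n) = UNIV"
      unfolding O'_def by auto
    ultimately show ?thesis by simp
  qed
  moreover have "(\<Union>n. A n) = (\<lambda>\<alpha>. g (\<alpha> 0) (sh \<alpha>)) ` D"
  proof (intro equalityI subsetI)
    fix x assume "x \<in> (\<Union>n. A n)"
    then obtain n \<alpha> where "\<alpha> \<in> C n" "x = g n \<alpha>" unfolding A by auto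
    then have "case_nat n \<alpha> \<in> D" "x = g (case_nat n \<alpha> 0) (sh (case_nat n \<alpha>))"
      by (auto simp: D_def sh_def)
    then show "x \<in> (\<lambda>\<alpha>. g (\<alpha> 0) (sh \<alpha>)) ` D" by blast
  qed (auto simp: D_def A)
  ultimately show ?thesis unfolding analytic_def by blast
qed

text \<open>The pairing function splits one sequence into countably many, so one point of Baire
  space can carry a whole sequence of codes.\<close>

definition strand :: "nat \<Rightarrow> (nat \<Rightarrow> 'b) \<Rightarrow> nat \<Rightarrow> 'b" where
  "strand n \<alpha> = (\<lambda>k. \<alpha> (prod_encode (n, k)))"

lemma continuous_on_strand: "continuous_on UNIV (strand n :: (nat \<Rightarrow> 'b::topological_space) \<Rightarrow> _)"
  unfolding strand_def[abs_def] by (rule continuous_on_reindex)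

lemma ex_strands: "\<exists>\<alpha>. \<forall>n. strand n \<alpha> = \<beta> n"
  by (rule exI[of _ "\<lambda>i. \<beta> (fst (prod_decode i)) (snd (prod_decode i))"]) (auto simp: strand_def fun_eq_iff)

text \<open>A common point is coded by one code for each set, all with the same value. Agreement of
  values is a closed condition because the target is Hausdorff.\<close>

lemma analytic_INT:
  fixes A :: "nat \<Rightarrow> 'b::t2_space set"
  assumes "\<And>n. analytic (A n)"
  shows "analytic (\<Inter>n. A n)"
proof -
  have "\<exists>C (g :: (nat \<Rightarrow> nat) \<Rightarrow> 'b). closed C \<and> continuous_on UNIV g \<and> A n = g ` C" for n
    using assms[of n] unfolding analytic_def .
  then obtain C and g :: "nat \<Rightarrow> (nat \<Rightarrow> nat) \<Rightarrow> 'b"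
    where C: "\<And>n. closed (C n)" and g: "\<And>n. continuous_on UNIV (g n)" and A: "\<And>n. A n = g n ` C n"
    by metis
  have gr: "continuous_on UNIV (\<lambda>\<alpha>. g n (strand n \<alpha>))" for n
    using continuous_on_compose2[OF g continuous_on_strand] by auto
  define D where "D = {\<alpha>. \<forall>n. strand n \<alpha> \<in> C n \<and> g n (strand n \<alpha>) = g 0 (strand 0 \<alpha>)}"
  have "D = (\<Inter>n. strand n -` C n \<inter> {\<alpha>. g n (strand n \<alpha>) = g 0 (strand 0 \<alpha>)})"
    unfolding D_def by auto
  moreover have "closed {\<alpha>. g n (strand n \<alpha>) = g 0 (strand 0 \<alpha>)}" for n
    by (rule closed_Collect_eq[OF gr gr])
  ultimately have "closed D"
    using closed_vimage_UNIV[OF C continuous_on_strand] by (auto intro!: closed_INT closed_Int)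
  moreover have "(\<Inter>n. A n) = (\<lambda>\<alpha>. g 0 (strand 0 \<alpha>)) ` D"
  proof (intro equalityI subsetI)
    fix x assume "x \<in> (\<Inter>n. A n)"
    then have "\<forall>n. \<exists>\<alpha>\<in>C n. g n \<alpha> = x" unfolding A by auto
    then obtain \<beta> where \<beta>: "\<And>n. \<beta> n \<in> C n" "\<And>n. g n (\<beta> n) = x" by metis
    obtain \<alpha> where "\<forall>n. strand n \<alpha> = \<beta> n" using ex_strands by blast
    then have "\<alpha> \<in> D" "x = g 0 (strand 0 \<alpha>)" using \<beta> by (auto simp: D_def)
    then show "x \<in> (\<lambda>\<alpha>. g 0 (strand 0 \<alpha>)) ` D" by blast
  next
    fix x assume "x \<in> (\<lambda>\<alpha>. g 0 (strand 0 \<alpha>)) ` D"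
    then obtain \<alpha> where \<alpha>: "\<alpha> \<in> D" "x = g 0 (strand 0 \<alpha>)" by blast
    then have "strand n \<alpha> \<in> C n" "x = g n (strand n \<alpha>)" for n
      unfolding D_def by (simp, metis (mono_tags, lifting) mem_Collect_eq)
    then show "x \<in> (\<Inter>n. A n)" unfolding A by blast
  qed
  ultimately show ?thesis unfolding analytic_def using gr by blast
qed

lemma analytic_Un: "analytic A \<Longrightarrow> analytic B \<Longrightarrow> analytic (A \<union> B)"
proof -
  assume "analytic A" "analytic B"
  then have "analytic (\<Union>n::nat. if n = 0 then A else B)" by (intro analytic_UN) auto
  moreover have "(\<Union>n::nat. if n = 0 then A else B) = A \<union> B" by (auto split: if_splits)
  ultimately show ?thesis by simp
qed

lemma analytic_Int: "analytic A \<Longrightarrow> analytic B \<Longrightarrow> analytic (A \<inter> B)"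
  for A B :: "'b::t2_space set"
proof -
  assume "analytic A" "analytic B"
  then have "analytic (\<Inter>n::nat. if n = 0 then A else B)" by (intro analytic_INT) auto
  moreover have "(\<Inter>n::nat. if n = 0 then A else B) = A \<inter> B" by (auto split: if_splits)
  ultimately show ?thesis by simp
qed

lemma borel_imp_analytic:
  fixes A :: "'b::t2_space set" and h :: "(nat \<Rightarrow> nat) \<Rightarrow> 'b"
  assumes fsigma: "\<And>U :: 'b set. open U \<Longrightarrow> \<exists>C :: nat \<Rightarrow> 'b set. (\<forall>n. closed (C n)) \<and> U = (\<Union>n. C n)"
    and h: "continuous_on UNIV h" "surj h" and "A \<in> sets borel"
  shows "analytic A"
proof -
  have closed: "analytic C" if "closed C" for C :: "'b set"
  proof -
    have "C = h ` (h -` C)" using \<open>surj h\<close> by auto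
    then show ?thesis
      unfolding analytic_def using closed_vimage_UNIV[OF that h(1)] h(1) by blast
  qed
  have "A \<in> sigma_sets UNIV {S. open S}" using assms(4) by (simp add: borel_def)
  \<comment> \<open>Analyticity does not pass to complements in general, so the induction carries
    the complement along.\<close>
  then have "analytic A \<and> analytic (- A)"
  proof induction
    case (Basic a)
    then obtain C :: "nat \<Rightarrow> 'b set" where "\<And>n. closed (C n)" "a = (\<Union>n. C n)"
      using fsigma[of a] by auto
    then have "analytic a" using analytic_UN[of C] closed by auto
    then show ?case using Basic closed by auto
  next
    case Empty
    then show ?case using closed by auto
  next
    case (Compl a)
    then show ?case by (simp add: Compl_eq_Diff_UNIV[symmetric])
  next
    case (Union a)
    have "- \<Union> (range a) = (\<Inter>n. - a n)" by auto
    then show ?case using Union analytic_UN[of a] analytic_INT[of "\<lambda>n. - a n"] by auto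
  qed
  then show ?thesis ..
qed

section \<open>Separation of analytic sets by Borel sets\<close>

definition borel_separable :: "(nat \<Rightarrow> 'b::topological_space set) \<Rightarrow> bool" where
  "borel_separable A \<longleftrightarrow>
     (\<exists>B. (\<forall>n. A n \<subseteq> B n \<and> B n \<in> sets borel) \<and> (\<Inter>n. B n) = {})"

lemma borel_separable_mono:
  assumes "borel_separable A" "\<And>n. A' n \<subseteq> A n"
  shows "borel_separable A'"
proof -
  obtain B where "\<And>n. A n \<subseteq> B n" "\<And>n. B n \<in> sets borel" "(\<Inter>n. B n) = {}"
    using assms(1) unfolding borel_separable_def by auto
  then show ?thesis unfolding borel_separable_def using order_trans[OF assms(2)] by blast
qed

lemma borel_separableI:
  assumes "i \<noteq> j" "A i \<subseteq> U" "A j \<subseteq> V" "U \<in> sets borel" "V \<in> sets borel" "U \<inter> V = {}"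
  shows "borel_separable A"
proof -
  define B where "B n = (if n = i then U else if n = j then V else UNIV)" for n
  have "B i = U" "B j = V" using assms(1) by (auto simp: B_def)
  then have "(\<Inter>n. B n) = {}" using assms(6) by blast
  moreover have "A n \<subseteq> B n \<and> B n \<in> sets borel" for n
    using assms by (auto simp: B_def)
  ultimately show ?thesis unfolding borel_separable_def by blast
qed

text \<open>Read contrapositively: if a member of a non-separable sequence is split into countably
  many pieces, some piece keeps the sequence non-separable. The hulls are united at index
  \<open>i\<close> and intersected elsewhere.\<close>

lemma borel_separable_UN:
  fixes A' :: "nat \<Rightarrow> 'b::topological_space set"
  assumes sep: "\<And>j. borel_separable (A(i := A' j))"
  shows "borel_separable (A(i := \<Union>j. A' j))"
proof -
  have "\<exists>B. (\<forall>n. (A(i := A' j)) n \<subseteq> B n \<and> B n \<in> sets borel) \<and> (\<Inter>n. B n) = {}" for j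
    using sep[of j] unfolding borel_separable_def .
  then obtain B where B: "\<And>j n. (A(i := A' j)) n \<subseteq> B j n" "\<And>j n. B j n \<in> sets borel"
    "\<And>j. (\<Inter>n. B j n) = {}" by metis
  define B' where "B' n = (if n = i then \<Union>j. B j i else \<Inter>j. B j n)" for n
  have "(A(i := \<Union>j. A' j)) n \<subseteq> B' n" for n
    using B(1)[of _ n] by (fastforce simp: B'_def split: if_splits)
  moreover have "B' n \<in> sets borel" for n
    unfolding B'_def using B(2) by auto
  moreover have "(\<Inter>n. B' n) = {}"
  proof (rule ccontr)
    assume "(\<Inter>n. B' n) \<noteq> {}"
    then obtain x where x: "\<And>n. x \<in> B' n" by blast
    then obtain j where "x \<in> B j i" using x[of i] by (auto simp: B'_def)
    then have "x \<in> B j n" for n using x[of n] by (cases "n = i") (auto simp: B'_def)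
    then show False using B(3)[of j] by blast
  qed
  ultimately show ?thesis unfolding borel_separable_def by blast
qed

lemma open_contains_cylinder:
  fixes U :: "(nat \<Rightarrow> nat) set"
  assumes "open U" "\<alpha> \<in> U"
  shows "\<exists>N. \<forall>\<beta>. (\<forall>k<N. \<beta> k = \<alpha> k) \<longrightarrow> \<beta> \<in> U"
proof -
  have "openin (product_topology (\<lambda>i::nat. euclidean :: nat topology) UNIV) U"
    using assms(1) by (simp add: euclidean_product_topology)
  then obtain X where X: "\<alpha> \<in> Pi\<^sub>E UNIV X" "finite {i. X i \<noteq> UNIV}" "Pi\<^sub>E UNIV X \<subseteq> U"
    using product_topology_open_contains_basis[OF _ assms(2)] by force
  obtain N where N: "\<And>i. X i \<noteq> UNIV \<Longrightarrow> i < N"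
    using X(2) unfolding finite_nat_set_iff_bounded by auto
  have "\<beta> \<in> U" if "\<forall>k<N. \<beta> k = \<alpha> k" for \<beta>
  proof -
    have "\<beta> i \<in> X i" for i using that N[of i] X(1) by (cases "X i = UNIV") (auto simp: PiE_iff)
    then show ?thesis using X(3) by auto
  qed
  then show ?thesis by blast
qed

text \<open>
  If the sequence were not separable, one could successively fix the digits of witnesses
  \<open>\<alpha>\<^sub>0, \<alpha>\<^sub>1, \<dots>\<close> (encoded as the rows of a single \<open>\<beta>\<close>) so that the parts of the sets cut out by
  every finite stage remain non-separable.
\<close>

lemma novikov_separation:
  fixes A :: "nat \<Rightarrow> 'b::t2_space set"
  assumes an: "\<And>n. analytic (A n)" and "(\<Inter>n. A n) = {}"
  shows "borel_separable A"
proof (rule ccontr)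
  assume nsep: "\<not> borel_separable A"
  have "\<exists>C (g :: (nat \<Rightarrow> nat) \<Rightarrow> 'b). closed C \<and> continuous_on UNIV g \<and> A n = g ` C" for n
    using an[of n] unfolding analytic_def .
  then obtain C and g :: "nat \<Rightarrow> (nat \<Rightarrow> nat) \<Rightarrow> 'b"
    where C: "\<And>n. closed (C n)" and g: "\<And>n. continuous_on UNIV (g n)" and A: "\<And>n. A n = g n ` C n"
    by metis
  \<comment> \<open>The entry of \<open>xs\<close> at position \<open>prod_encode (i, k)\<close>
    prescribes digit \<open>k\<close> of the code of the \<open>i\<close>-th witness.\<close>
  define S where "S xs i = g i ` {\<alpha> \<in> C i. \<forall>k. prod_encode (i, k) < length xs \<longrightarrow> \<alpha> k = xs ! prod_encode (i, k)}"
    for xs :: "nat list" and i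
  have step: "\<exists>j. \<not> borel_separable (S (xs @ [j]))" if "\<not> borel_separable (S xs)" for xs
  proof (rule ccontr)
    assume *: "\<not> (\<exists>j. \<not> borel_separable (S (xs @ [j])))"
    \<comment> \<open>Position \<open>length xs\<close> encodes exactly one pair, so appending a
      digit refines a single set, the one with index \<open>i\<close>.\<close>
    obtain i k where ik: "prod_encode (i, k) = length xs"
      by (metis prod_decode_inverse surj_pair)
    have "S (xs @ [j]) = (S xs)(i := S (xs @ [j]) i)" for j
    proof
      fix i' show "S (xs @ [j]) i' = ((S xs)(i := S (xs @ [j]) i)) i'"
      proof (cases "i' = i")
        case False
        then have "prod_encode (i', k') < length (xs @ [j]) \<longleftrightarrow> prod_encode (i', k') < length xs" for k'
          using ik by (metis length_append_singleton less_Suc_eq prod.inject prod_encode_eq)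
        then show ?thesis using False unfolding S_def by (auto simp: nth_append)
      qed simp
    qed
    then have "borel_separable ((S xs)(i := \<Union>j. S (xs @ [j]) i))"
      using * by (intro borel_separable_UN) metis
    moreover have "S xs i \<subseteq> (\<Union>j. S (xs @ [j]) i)"
    proof
      fix y assume "y \<in> S xs i"
      then obtain \<alpha> where \<alpha>: "\<alpha> \<in> C i" "y = g i \<alpha>"
        "\<And>k. prod_encode (i, k) < length xs \<Longrightarrow> \<alpha> k = xs ! prod_encode (i, k)"
        unfolding S_def by blast
      have "\<alpha> k' = (xs @ [\<alpha> k]) ! prod_encode (i, k')" if "prod_encode (i, k') < Suc (length xs)" for k'
      proof (cases "prod_encode (i, k') < length xs")
        case True
        then show ?thesis using \<alpha>(3) by (simp add: nth_append)
      next
        case False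
        then have "prod_encode (i, k') = prod_encode (i, k)" using that ik by simp
        then have "k' = k" by simp
        then show ?thesis using ik by simp
      qed
      then have "y \<in> S (xs @ [\<alpha> k]) i" unfolding S_def using \<alpha>(1,2) by auto
      then show "y \<in> (\<Union>j. S (xs @ [j]) i)" by blast
    qed
    ultimately have "borel_separable (S xs)"
      by (elim borel_separable_mono) (auto split: if_splits)
    then show False using that by simp
  qed
  define L where "L = rec_nat [] (\<lambda>_ xs. xs @ [SOME j. \<not> borel_separable (S (xs @ [j]))])"
  have L0: "L 0 = []" and LS: "L (Suc t) = L t @ [SOME j. \<not> borel_separable (S (L t @ [j]))]" for t
    unfolding L_def by auto
  have nsepL: "\<not> borel_separable (S (L t))" for t
  proof (induction t)
    case 0
    then show ?case using nsep by (simp add: L0 S_def A[symmetric])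
  next
    case (Suc t)
    show ?case unfolding LS by (rule someI_ex[OF step[OF Suc]])
  qed
  have len: "length (L t) = t" for t by (induction t) (auto simp: L0 LS)
  define \<beta> where "\<beta> t = L (Suc t) ! t" for t
  have L_nth: "L t ! s = \<beta> s" if "s < t" for s t
    using that
  proof (induction t)
    case (Suc t)
    then show ?case
      by (cases "s = t") (auto simp: \<beta>_def LS nth_append len)
  qed simp
  have S_sub: "S (L t) i \<subseteq> g i ` {\<alpha> \<in> C i. \<forall>k<N. \<alpha> k = strand i \<beta> k}"
    if "\<And>k. k < N \<Longrightarrow> prod_encode (i, k) < t" for t i N
    unfolding S_def strand_def using that by (auto simp: len L_nth)
  have ex_t: "\<exists>t. \<forall>k<N. prod_encode (i, k) < t" for i N
    using finite_nat_set_iff_bounded[of "(\<lambda>k. prod_encode (i, k)) ` {..<N}"] by auto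
  \<comment> \<open>If a limit code left the closed set \<open>C i\<close>, some finite stage would
    already have an empty \<open>i\<close>-th set, and an empty member makes a sequence
    separable.\<close>
  have inC: "strand i \<beta> \<in> C i" for i
  proof (rule ccontr)
    assume "strand i \<beta> \<notin> C i"
    then obtain N where N: "\<forall>\<alpha>. (\<forall>k<N. \<alpha> k = strand i \<beta> k) \<longrightarrow> \<alpha> \<in> - C i"
      using open_contains_cylinder[of "- C i" "strand i \<beta>"] C by auto
    obtain t where "\<forall>k<N. prod_encode (i, k) < t" using ex_t[of N i] by auto
    moreover have "{\<alpha> \<in> C i. \<forall>k<N. \<alpha> k = strand i \<beta> k} = {}" using N by blast
    ultimately have "S (L t) i \<subseteq> {}" using S_sub[of N i t] by (metis image_empty)
    then have "borel_separable (S (L t))"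
      by (intro borel_separableI[of i "Suc i" _ "{}" UNIV]) auto
    then show False using nsepL by simp
  qed
  \<comment> \<open>Not all limit codes have the same value. Two different values have disjoint open
    neighbourhoods, which by continuity contain the corresponding sets of a finite stage.\<close>
  have "\<exists>i. g i (strand i \<beta>) \<noteq> g 0 (strand 0 \<beta>)"
  proof (rule ccontr)
    assume "\<nexists>i. g i (strand i \<beta>) \<noteq> g 0 (strand 0 \<beta>)"
    then have "g 0 (strand 0 \<beta>) \<in> A i" for i using inC[of i] unfolding A by (metis image_eqI)
    then show False using assms(2) by blast
  qed
  then obtain i where "g i (strand i \<beta>) \<noteq> g 0 (strand 0 \<beta>)" by blast
  from hausdorff[OF this] obtain U V
    where UV: "open U" "open V" "g i (strand i \<beta>) \<in> U" "g 0 (strand 0 \<beta>) \<in> V" "U \<inter> V = {}"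
    by blast
  have "\<exists>N. \<forall>\<alpha>. (\<forall>k<N. \<alpha> k = strand j \<beta> k) \<longrightarrow> g j \<alpha> \<in> W" if "open W" "g j (strand j \<beta>) \<in> W" for j W
    using open_contains_cylinder[OF open_vimage[OF that(1) g[of j]], of "strand j \<beta>"] that(2)
    unfolding vimage_eq by blast
  note cyl = this
  obtain N where N: "\<forall>\<alpha>. (\<forall>k<N. \<alpha> k = strand i \<beta> k) \<longrightarrow> g i \<alpha> \<in> U"
    using cyl[OF UV(1,3)] by blast
  obtain N' where N': "\<forall>\<alpha>. (\<forall>k<N'. \<alpha> k = strand 0 \<beta> k) \<longrightarrow> g 0 \<alpha> \<in> V"
    using cyl[OF UV(2,4)] by blast
  obtain t t' where t: "\<forall>k<N. prod_encode (i, k) < t" and t': "\<forall>k<N'. prod_encode (0, k) < t'"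
    using ex_t[of N i] ex_t[of N' 0] by auto
  have "S (L (max t t')) i \<subseteq> g i ` {\<alpha> \<in> C i. \<forall>k<N. \<alpha> k = strand i \<beta> k}"
    by (rule S_sub) (simp add: t less_max_iff_disj)
  also have "\<dots> \<subseteq> U" using N by blast
  finally have "S (L (max t t')) i \<subseteq> U" .
  moreover have "S (L (max t t')) 0 \<subseteq> g 0 ` {\<alpha> \<in> C 0. \<forall>k<N'. \<alpha> k = strand 0 \<beta> k}"
    by (rule S_sub) (simp add: t' less_max_iff_disj)
  then have "S (L (max t t')) 0 \<subseteq> V" using N' by blast
  moreover have "i \<noteq> 0" using \<open>g i (strand i \<beta>) \<noteq> g 0 (strand 0 \<beta>)\<close> by metis
  ultimately have "borel_separable (S (L (max t t')))"
    using UV by (intro borel_separableI[of i 0 _ U V]) auto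
  then show False using nsepL by simp
qed

lemma lusin_separation:
  fixes A B :: "'b::t2_space set"
  assumes "analytic A" "analytic B" "A \<inter> B = {}" "analytic (UNIV :: 'b set)"
  shows "\<exists>C \<in> sets borel. A \<subseteq> C \<and> C \<inter> B = {}"
proof -
  let ?S = "\<lambda>n::nat. if n = 0 then A else if n = 1 then B else UNIV"
  have "x \<in> ?S 0 \<and> x \<in> ?S 1 \<Longrightarrow> False" for x using assms(3) by auto
  then have "(\<Inter>n. ?S n) = {}" by blast
  then have "borel_separable ?S" using assms by (intro novikov_separation) auto
  then obtain S where S: "\<And>n. ?S n \<subseteq> S n" "\<And>n. S n \<in> sets borel" "(\<Inter>n. S n) = {}"
    unfolding borel_separable_def by blast
  have "x \<notin> B" if "x \<in> S 0" for x
  proof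
    assume "x \<in> B"
    then have "x \<in> S n" for n using S(1)[of n] that by (cases "n = 0"; cases "n = 1") auto
    then show False using S(3) by blast
  qed
  then show ?thesis using S(1)[of 0] S(2)[of 0] by auto
qed


section \<open>Borel sets with finite sections\<close>

lemma open_pair_eq_UN_closed:
  fixes U :: "((nat \<Rightarrow> nat) \<times> (nat \<Rightarrow> nat)) set"
  assumes "open U"
  shows "\<exists>C :: nat \<Rightarrow> _ set. (\<forall>n. closed (C n)) \<and> U = (\<Union>n. C n)"
proof -
  define cyl where "cyl xs = {\<alpha> :: nat \<Rightarrow> nat. \<forall>k<length xs. \<alpha> k = xs ! k}" for xs
  have closed_cyl: "closed (cyl xs)" for xs
  proof -
    have "cyl xs = (\<Inter>k\<in>{..<length xs}. (\<lambda>\<alpha>. \<alpha> k) -` {xs ! k})"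
      unfolding cyl_def by auto
    moreover have "closed ((\<lambda>\<alpha> :: nat \<Rightarrow> nat. \<alpha> k) -` {xs ! k})" for k
      by (rule closed_vimage_UNIV) auto
    ultimately show ?thesis by (simp add: closed_INT)
  qed
  define C where "C n = (case from_nat n of (xs, ys) \<Rightarrow>
      if cyl xs \<times> cyl ys \<subseteq> U then cyl xs \<times> cyl ys else {})" for n
  have "closed (C n)" for n
    unfolding C_def by (auto split: prod.split intro: closed_Times closed_cyl)
  moreover have "U = (\<Union>n. C n)"
  proof (intro equalityI subsetI)
    fix p assume "p \<in> U"
    then obtain A B where AB: "open A" "open B" "p \<in> A \<times> B" "A \<times> B \<subseteq> U"
      using open_prod_elim[OF assms] by blast
    then obtain \<alpha> \<beta> where p: "p = (\<alpha>, \<beta>)" "\<alpha> \<in> A" "\<beta> \<in> B" by blast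
    obtain N where N: "\<And>\<gamma>. (\<forall>k<N. \<gamma> k = \<alpha> k) \<Longrightarrow> \<gamma> \<in> A"
      using open_contains_cylinder[OF AB(1) p(2)] by blast
    obtain N' where N': "\<And>\<gamma>. (\<forall>k<N'. \<gamma> k = \<beta> k) \<Longrightarrow> \<gamma> \<in> B"
      using open_contains_cylinder[OF AB(2) p(3)] by blast
    let ?xs = "map \<alpha> [0..<N]" and ?ys = "map \<beta> [0..<N']"
    have "cyl ?xs \<subseteq> A" "cyl ?ys \<subseteq> B" unfolding cyl_def using N N' by auto
    then have "cyl ?xs \<times> cyl ?ys \<subseteq> U" using AB(4) by blast
    moreover have "p \<in> cyl ?xs \<times> cyl ?ys" unfolding p cyl_def by simp
    ultimately have "p \<in> C (to_nat (?xs, ?ys))" unfolding C_def by simp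
    then show "p \<in> (\<Union>n. C n)" by blast
  next
    fix p assume "p \<in> (\<Union>n. C n)"
    then obtain n where n: "p \<in> C n" by blast
    obtain xs ys where "from_nat n = (xs :: nat list, ys :: nat list)" by (rule prod.exhaust)
    then show "p \<in> U" using n unfolding C_def by (auto split: if_splits)
  qed
  ultimately show ?thesis by (intro exI[of _ C] conjI allI)
qed

lemma borel_imp_analytic_pair:
  fixes A :: "((nat \<Rightarrow> nat) \<times> (nat \<Rightarrow> nat)) set"
  assumes "A \<in> sets borel" shows "analytic A"
proof (rule borel_imp_analytic[OF _ _ _ assms])
  show "\<exists>C :: nat \<Rightarrow> _ set. (\<forall>n. closed (C n)) \<and> U = (\<Union>n. C n)"
    if "open U" for U :: "((nat \<Rightarrow> nat) \<times> (nat \<Rightarrow> nat)) set"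
    using that by (rule open_pair_eq_UN_closed)
  show "continuous_on UNIV (\<lambda>\<alpha>::nat \<Rightarrow> nat. (strand 0 \<alpha>, strand 1 \<alpha>))"
    by (intro continuous_on_Pair continuous_on_strand)
  show "surj (\<lambda>\<alpha>::nat \<Rightarrow> nat. (strand 0 \<alpha>, strand 1 \<alpha>))"
    unfolding surj_def
  proof
    fix p :: "(nat \<Rightarrow> nat) \<times> (nat \<Rightarrow> nat)"
    obtain \<alpha> where "\<forall>n. strand n \<alpha> = (if n = 0 then fst p else snd p)"
      using ex_strands[of "\<lambda>n. if n = 0 then fst p else snd p"] by blast
    then show "\<exists>\<alpha>. p = (strand 0 \<alpha>, strand 1 \<alpha>)" by (intro exI[of _ \<alpha>]) (simp add: prod_eq_iff)
  qed
qed

lemma analytic_UNIV: "analytic (UNIV :: (nat \<Rightarrow> nat) set)"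
  unfolding analytic_def using continuous_on_id[of UNIV] by (intro exI[of _ UNIV] exI[of _ "\<lambda>x. x"]) auto

lemma analytic_times_UNIV:
  fixes A :: "'b::topological_space set"
  assumes "analytic A"
  shows "analytic (A \<times> (UNIV :: (nat \<Rightarrow> nat) set))"
proof -
  obtain C and g :: "(nat \<Rightarrow> nat) \<Rightarrow> 'b" where C: "closed C" and g: "continuous_on UNIV g" and A: "A = g ` C"
    using assms unfolding analytic_def by blast
  let ?g = "\<lambda>\<alpha>. (g (strand 0 \<alpha>), strand 1 \<alpha> :: nat \<Rightarrow> nat)"
  have "continuous_on UNIV (\<lambda>\<alpha>. g (strand 0 \<alpha>))"
    using continuous_on_compose2[OF g continuous_on_strand] by auto
  then have "continuous_on UNIV ?g"
    by (intro continuous_on_Pair continuous_on_strand)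
  moreover have "closed (strand 0 -` C)"
    by (rule closed_vimage_UNIV[OF C continuous_on_strand])
  moreover have "A \<times> UNIV = ?g ` (strand 0 -` C)"
  proof (intro equalityI subsetI)
    fix p assume "p \<in> A \<times> (UNIV :: (nat \<Rightarrow> nat) set)"
    then obtain \<gamma> where \<gamma>: "\<gamma> \<in> C" "fst p = g \<gamma>" unfolding A by auto
    obtain \<alpha> where "\<forall>n. strand n \<alpha> = (if n = 0 then \<gamma> else snd p)"
      using ex_strands[of "\<lambda>n. if n = 0 then \<gamma> else snd p"] by blast
    then have "\<alpha> \<in> strand 0 -` C" "p = ?g \<alpha>" using \<gamma> by (auto simp: prod_eq_iff)
    then show "p \<in> ?g ` (strand 0 -` C)" by blast
  qed (auto simp: A)
  ultimately show ?thesis unfolding analytic_def by blast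
qed

lemma ex_basis_sequence:
  "\<exists>V :: nat \<Rightarrow> 'b::second_countable_topology set.
     (\<forall>n. open (V n)) \<and> (\<forall>U y. open U \<longrightarrow> y \<in> U \<longrightarrow> (\<exists>n. y \<in> V n \<and> V n \<subseteq> U))"
proof -
  obtain \<B> :: "'b set set" where \<B>: "countable \<B>" "\<And>C. C \<in> \<B> \<Longrightarrow> open C"
    "\<And>S. open S \<Longrightarrow> \<exists>U. U \<subseteq> \<B> \<and> S = \<Union>U"
    using univ_second_countable by blast
  obtain U where U: "U \<subseteq> \<B>" "UNIV = \<Union>U" using \<B>(3)[of UNIV] by auto
  then have ne: "\<B> \<noteq> {}" by auto
  have "open (from_nat_into \<B> n)" for n
    using \<B>(2) from_nat_into[OF ne] by blast
  moreover have "\<exists>n. y \<in> from_nat_into \<B> n \<and> from_nat_into \<B> n \<subseteq> S" if S: "open S" "y \<in> S" for S y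
  proof -
    obtain U where "U \<subseteq> \<B>" "S = \<Union>U" using \<B>(3)[OF S(1)] by blast
    then obtain C where "C \<in> \<B>" "y \<in> C" "C \<subseteq> S" using S(2) by blast
    then show ?thesis using from_nat_into_surj[OF \<B>(1), of C] by metis
  qed
  ultimately show ?thesis by (intro exI[of _ "from_nat_into \<B>"]) blast
qed

text \<open>
  The complement of a Borel set with closed sections is a countable union of rectangles with Borel
  and open sides, so by compactness emptiness of a section is decided by finitely many of them.
\<close>

lemma borel_projection_compact_sections:
  fixes Q :: "((nat \<Rightarrow> nat) \<times> (nat \<Rightarrow> nat)) set"
  assumes Q: "Q \<in> sets borel" "Q \<subseteq> UNIV \<times> K" "\<And>x. closed {y. (x, y) \<in> Q}" and K: "compact K"
  shows "fst ` Q \<in> sets borel"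
proof -
  obtain V :: "nat \<Rightarrow> (nat \<Rightarrow> nat) set" where V: "\<And>n. open (V n)"
    "\<And>U y. open U \<Longrightarrow> y \<in> U \<Longrightarrow> \<exists>n. y \<in> V n \<and> V n \<subseteq> U"
    using ex_basis_sequence by metis
  define W where "W n = fst ` (Q \<inter> (UNIV \<times> V n))" for n
  have snd_V: "UNIV \<times> V n \<in> sets borel" for n
    using V(1)[of n] by (intro borel_open open_Times) auto
  have anW: "analytic (W n)" for n
    unfolding W_def using Q(1) snd_V
    by (intro analytic_image borel_imp_analytic_pair continuous_on_fst continuous_on_id) auto
  \<comment> \<open>\<open>W n\<close> collects the points whose section meets \<open>V n\<close>. A
    point outside \<open>Q\<close> lies in \<open>S n\<close> if \<open>V n\<close> is no witness
    for this, because it meets the section or misses the second coordinate. As sections are closed,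
    some \<open>V n\<close> is a witness.\<close>
  define S where "S n = - Q \<inter> (W n \<times> UNIV \<union> - (UNIV \<times> V n))" for n
  have anS: "analytic (S n)" for n
    unfolding S_def
    by (rule analytic_Int[OF borel_imp_analytic_pair[OF borel_comp[OF Q(1)]]
          analytic_Un[OF analytic_times_UNIV[OF anW] borel_imp_analytic_pair[OF borel_comp[OF snd_V]]]])
  have "(\<Inter>n. S n) = {}"
  proof (rule ccontr)
    assume "(\<Inter>n. S n) \<noteq> {}"
    then obtain x y where xy: "\<And>n. (x, y) \<in> S n" by auto
    then have "y \<in> - {y. (x, y) \<in> Q}" unfolding S_def by blast
    then obtain n where "y \<in> V n" "V n \<subseteq> - {y. (x, y) \<in> Q}"
      using V(2)[of "- {y. (x, y) \<in> Q}" y] Q(3)[of x] by auto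
    then show False using xy[of n] unfolding S_def W_def by auto
  qed
  from novikov_separation[OF anS this] obtain B where
    B: "\<And>n. S n \<subseteq> B n" "\<And>n. B n \<in> sets borel" "(\<Inter>n. B n) = {}"
    unfolding borel_separable_def by auto
  \<comment> \<open>Off \<open>Q\<close> and \<open>B n\<close> the set \<open>V n\<close> is a
    witness, but \<open>W n\<close> is only known to be analytic. So a Borel set \<open>C n\<close>
    avoiding it is put around the projection; the rectangles \<open>C n \<times> V n\<close> then
    cover exactly the complement of \<open>Q\<close>.\<close>
  have "\<exists>C \<in> sets borel. fst ` (- Q - B n) \<subseteq> C \<and> C \<inter> W n = {}" for n
  proof (rule lusin_separation[OF _ anW])
    show "analytic (fst ` (- Q - B n))"
      using Q(1) B(2)[of n]
      by (intro analytic_image borel_imp_analytic_pair continuous_on_fst continuous_on_id) auto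
    show "fst ` (- Q - B n) \<inter> W n = {}" using B(1)[of n] unfolding S_def by auto
  qed (rule analytic_UNIV)
  then obtain C where C: "\<And>n. C n \<in> sets borel" "\<And>n. fst ` (- Q - B n) \<subseteq> C n" "\<And>n. C n \<inter> W n = {}"
    by metis
  have mQ: "(x, y) \<notin> Q \<longleftrightarrow> (\<exists>n. x \<in> C n \<and> y \<in> V n)" for x y
  proof
    assume "(x, y) \<notin> Q"
    then obtain n where n: "(x, y) \<notin> B n" using B(3) by blast
    then have "x \<in> C n" using C(2)[of n] \<open>(x, y) \<notin> Q\<close> by force
    moreover have "y \<in> V n" using n B(1)[of n] \<open>(x, y) \<notin> Q\<close> unfolding S_def by auto
    ultimately show "\<exists>n. x \<in> C n \<and> y \<in> V n" by blast
  next
    assume "\<exists>n. x \<in> C n \<and> y \<in> V n"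
    then show "(x, y) \<notin> Q" using C(3) unfolding W_def by force
  qed
  define \<S> where "\<S> = {I. finite I \<and> K \<subseteq> (\<Union>n\<in>I. V n)}"
  have "x \<notin> fst ` Q \<longleftrightarrow> (\<exists>I\<in>\<S>. \<forall>n\<in>I. x \<in> C n)" for x
  proof
    assume "x \<notin> fst ` Q"
    then have "K \<subseteq> (\<Union>n\<in>{n. x \<in> C n}. V n)" using mQ by force
    then obtain I where "I \<subseteq> {n. x \<in> C n}" "finite I" "K \<subseteq> (\<Union>n\<in>I. V n)"
      using compactE_image[OF K, of "{n. x \<in> C n}" V] V(1) by metis
    then show "\<exists>I\<in>\<S>. \<forall>n\<in>I. x \<in> C n" unfolding \<S>_def by blast
  next
    assume "\<exists>I\<in>\<S>. \<forall>n\<in>I. x \<in> C n"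
    then show "x \<notin> fst ` Q" using mQ Q(2) unfolding \<S>_def by fastforce
  qed
  then have "- (fst ` Q) = (\<Union>I\<in>\<S>. \<Inter>n\<in>I. C n)" by auto
  moreover have "countable \<S>"
    by (rule countable_subset[OF _ countable_Collect_finite]) (auto simp: \<S>_def)
  moreover have "(\<Inter>n\<in>I. C n) \<in> sets borel" for I
    using C(1) by (cases "I = {}") (auto intro!: sets.countable_INT')
  ultimately have "- (fst ` Q) \<in> sets borel" by (auto intro!: sets.countable_UN')
  then have "- (- (fst ` Q)) \<in> sets borel" by (rule borel_comp)
  then show ?thesis by simp
qed

section \<open>Standard Borel spaces inside Cantor space\<close>

lemma measurable_coordinate: "(\<lambda>z :: nat \<Rightarrow> nat. z n) \<in> borel \<rightarrow>\<^sub>M count_space UNIV"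
proof (rule measurableI)
  fix A :: "nat set"
  have "open ((\<lambda>z :: nat \<Rightarrow> nat. z n) -` A)"
    by (rule open_vimage) (auto simp: open_discrete)
  then show "(\<lambda>z :: nat \<Rightarrow> nat. z n) -` A \<inter> space borel \<in> sets borel" by simp
qed simp

lemma compact_binary_sequences: "compact {z :: nat \<Rightarrow> nat. \<forall>n. z n \<le> 1}"
proof -
  have "compactin (product_topology (\<lambda>i::nat. euclidean :: nat topology) UNIV) (Pi\<^sub>E UNIV (\<lambda>_. {..1}))"
    by (simp add: compactin_PiE finite_imp_compact)
  moreover have "Pi\<^sub>E UNIV (\<lambda>_. {..1}) = {z :: nat \<Rightarrow> nat. \<forall>n. z n \<le> 1}"
    by (auto simp: PiE_iff)
  ultimately show ?thesis by (simp add: euclidean_product_topology)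
qed

text \<open>A point is coded by the basic open sets containing it. Measurability of the inverse
  rests on a Borel description of the set of codes, from which completeness recovers the
  point.\<close>

lemma standard_borel_embedding:
  assumes "standard_borel M" "space M \<noteq> {}"
  shows "\<exists>(\<phi> :: 'a \<Rightarrow> nat \<Rightarrow> nat) \<psi>. \<phi> \<in> M \<rightarrow>\<^sub>M borel \<and> \<psi> \<in> borel \<rightarrow>\<^sub>M M \<and>
           (\<forall>x\<in>space M. \<psi> (\<phi> x) = x \<and> (\<forall>n. \<phi> x n \<le> 1))"
proof -
  obtain T where T: "topspace T = space M" "completely_metrizable_space T" "second_countable T"
    "sets M = sigma_sets (space M) {U. openin T U}"
    using assms(1) unfolding standard_borel_def by blast
  obtain S d where "Metric_space S d" and complete: "Metric_space.mcomplete S d"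
    and T_eq: "T = Metric_space.mtopology S d"
    using T(2) unfolding completely_metrizable_space_def by blast
  interpret Metric_space S d by fact
  have S: "S = space M" using T(1) T_eq by simp
  obtain x0 where x0: "x0 \<in> S" using assms(2) S by blast
  obtain \<B> where \<B>: "countable \<B>" "\<And>V. V \<in> \<B> \<Longrightarrow> openin T V"
    "\<And>U x. openin T U \<Longrightarrow> x \<in> U \<Longrightarrow> \<exists>V\<in>\<B>. x \<in> V \<and> V \<subseteq> U"
    using T(3) unfolding second_countable_def by metis
  have "\<B> \<noteq> {}" using \<B>(3)[OF openin_topspace, of x0] x0 S T(1) by auto
  define U where "U = from_nat_into \<B>"
  have U_open: "openin T (U n)" for n
    using \<B>(2) from_nat_into[OF \<open>\<B> \<noteq> {}\<close>] unfolding U_def by blast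
  have U_S: "U n \<subseteq> S" for n using openin_subset[OF U_open] T(1) S by simp
  have U_basis: "\<exists>n. x \<in> U n \<and> U n \<subseteq> W" if "openin T W" "x \<in> W" for W x
    using \<B>(3)[OF that] from_nat_into_surj[OF \<B>(1)] unfolding U_def by metis
  have U_ball: "\<exists>n. x \<in> U n \<and> U n \<subseteq> mball x r" if "x \<in> S" "r > 0" for x r
    using U_basis[of "mball x r" x] that T_eq by auto
  have U_contains_ball: "\<exists>r>0. mball x r \<subseteq> U n" if "x \<in> U n" for x n
    using U_open[of n] that unfolding T_eq openin_mtopology by blast
  have cl: "T closure_of X = {x \<in> S. \<forall>r>0. \<exists>y\<in>X. y \<in> mball x r}" for X
    unfolding T_eq metric_closure_of ..
  have U_cl: "U n \<subseteq> T closure_of U n" for n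
    by (rule closure_of_subset) (use U_S T(1) S in auto)

  define \<phi> :: "'a \<Rightarrow> nat \<Rightarrow> nat" where "\<phi> x n = (if x \<in> U n then 1 else 0)" for x n
  define small where "small e n \<longleftrightarrow> (\<forall>a\<in>U n. \<forall>b\<in>U n. d a b < 1 / Suc e)" for e n
  \<comment> \<open>The conditions ask for binary digits, arbitrarily small selected sets, a common
    point for every finite selection, and regularity. A limit of the common points is known to lie
    only in the closures of the selected sets; regularity moves it into the sets and forces every
    basic set around it to be selected.\<close>
  define G where "G = {z :: nat \<Rightarrow> nat. (\<forall>n. z n \<le> 1) \<and> (\<forall>e. \<exists>n. z n = 1 \<and> small e n) \<and>
      (\<forall>N. \<exists>x\<in>S. \<forall>n<N. z n = 1 \<longrightarrow> x \<in> U n) \<and>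
      (\<forall>n. z n = 1 \<longleftrightarrow> (\<exists>m. z m = 1 \<and> T closure_of U m \<subseteq> U n))}"

  have \<phi>_G: "\<phi> x \<in> G" if x: "x \<in> S" for x
  proof -
    have \<phi>1: "\<phi> x n = 1 \<longleftrightarrow> x \<in> U n" "\<phi> x n \<le> 1" for n unfolding \<phi>_def by auto
    have 1: "\<exists>n. x \<in> U n \<and> small e n" for e
    proof -
      define \<delta> :: real where "\<delta> = 1 / Suc e / 2"
      obtain n where n: "x \<in> U n" "U n \<subseteq> mball x \<delta>"
        using U_ball[OF x, of \<delta>] unfolding \<delta>_def by auto
      have "d a b < 1 / Suc e" if "a \<in> U n" "b \<in> U n" for a b
      proof -
        have "d x a < \<delta>" "d x b < \<delta>" "a \<in> S" "b \<in> S"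
          using that n(2) by auto
        moreover have "d a b \<le> d x a + d x b"
          using triangle[of a x b] commute[of a x] \<open>a \<in> S\<close> \<open>b \<in> S\<close> x by simp
        moreover have "\<delta> + \<delta> = 1 / Suc e" unfolding \<delta>_def by (rule field_sum_of_halves)
        ultimately show ?thesis by linarith
      qed
      then show ?thesis using n unfolding small_def by blast
    qed
    have 2: "x \<in> U n \<longleftrightarrow> (\<exists>m. x \<in> U m \<and> T closure_of U m \<subseteq> U n)" for n
    proof
      assume "x \<in> U n"
      then obtain r where r: "r > 0" "mball x r \<subseteq> U n" using U_contains_ball by blast
      obtain m where m: "x \<in> U m" "U m \<subseteq> mball x (r / 2)" using U_ball[OF x, of "r / 2"] r by auto
      have "a \<in> mball x r" if a: "a \<in> T closure_of U m" for a
      proof -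
        obtain y where y: "y \<in> U m" "y \<in> mball a (r / 2)" "a \<in> S" using a r unfolding cl by (auto dest: spec[of _ "r / 2"])
        then have "d x y < r / 2" "d a y < r / 2" "y \<in> S" using m by auto
        then show ?thesis using triangle[of x y a] commute[of a y] x y by auto
      qed
      then show "\<exists>m. x \<in> U m \<and> T closure_of U m \<subseteq> U n" using m r by blast
    next
      assume "\<exists>m. x \<in> U m \<and> T closure_of U m \<subseteq> U n"
      then show "x \<in> U n" using U_cl by blast
    qed
    have "\<exists>x'\<in>S. \<forall>n<N. x \<in> U n \<longrightarrow> x' \<in> U n" for N :: nat using x by blast
    then show ?thesis
      unfolding G_def mem_Collect_eq \<phi>1(1) by (intro conjI allI \<phi>1(2) 1 2)
  qed

  have G_\<phi>: "\<exists>x\<in>S. \<phi> x = z" if z: "z \<in> G" for z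
  proof -
    note zG = z[unfolded G_def mem_Collect_eq]
    note z1 = zG[THEN conjunct1, rule_format]
    note z2 = zG[THEN conjunct2, THEN conjunct1, rule_format]
    note z3 = zG[THEN conjunct2, THEN conjunct2, THEN conjunct1, rule_format]
    note z4 = zG[THEN conjunct2, THEN conjunct2, THEN conjunct2, rule_format]
    obtain k where k: "\<And>e. z (k e) = 1" "\<And>e. small e (k e)" using z2 by metis
    obtain x where x: "\<And>N. x N \<in> S" "\<And>N n. n < N \<Longrightarrow> z n = 1 \<Longrightarrow> x N \<in> U n" using z3 by metis
    have "MCauchy x"
      unfolding MCauchy_def
    proof (intro conjI allI impI)
      show "range x \<subseteq> S" using x(1) by auto
      fix \<epsilon> :: real assume "\<epsilon> > 0"
      then obtain e where e: "1 / Suc e < \<epsilon>" using nat_approx_posE by blast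
      have "d (x i) (x j) < \<epsilon>" if "Suc (k e) \<le> i" "Suc (k e) \<le> j" for i j
        using k(2)[of e] x(2)[of "k e" i] x(2)[of "k e" j] k(1)[of e] that e unfolding small_def
        by fastforce
      then show "\<exists>N. \<forall>n n'. N \<le> n \<longrightarrow> N \<le> n' \<longrightarrow> d (x n) (x n') < \<epsilon>" by blast
    qed
    then obtain l where l: "limitin mtopology x l sequentially" using complete unfolding mcomplete_def by blast
    have lS: "l \<in> S" using l limitin_metric by blast
    have l_cl: "l \<in> T closure_of U m" if "z m = 1" for m
    proof -
      have "\<exists>y\<in>U m. y \<in> mball l r" if "r > 0" for r
      proof -
        have "\<forall>\<^sub>F n in sequentially. x n \<in> S \<and> d (x n) l < r" using l that unfolding limitin_metric by blast
        moreover have "\<forall>\<^sub>F n in sequentially. m < n" by (rule eventually_gt_at_top)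
        ultimately have "\<forall>\<^sub>F n in sequentially. x n \<in> S \<and> d (x n) l < r \<and> m < n"
          by eventually_elim auto
        then obtain n where "x n \<in> S" "d (x n) l < r" "m < n" by (auto dest: eventually_happens)
        then have "x n \<in> U m" "x n \<in> mball l r" using x(2)[of m n] \<open>z m = 1\<close> lS commute by auto
        then show ?thesis by blast
      qed
      then show ?thesis unfolding cl using lS by blast
    qed
    have z_U: "z n = 1 \<longleftrightarrow> l \<in> U n" for n
    proof
      assume "z n = 1"
      then show "l \<in> U n" using z4[of n] l_cl by blast
    next
      assume "l \<in> U n"
      then obtain r where r: "r > 0" "mball l r \<subseteq> U n" using U_contains_ball by blast
      \<comment> \<open>One third of \<open>r\<close> for each leg of the path from \<open>l\<close>
        through two points of \<open>U (k e)\<close> to \<open>a\<close>.\<close>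
      then obtain e where e: "1 / Suc e < r / 3" using nat_approx_posE[of "r / 3"] by auto
      have "a \<in> mball l r" if a: "a \<in> T closure_of U (k e)" for a
      proof -
        obtain b where b: "b \<in> U (k e)" "d a b < r / 3" "a \<in> S" "b \<in> S"
          using a r unfolding cl by (auto dest: spec[of _ "r / 3"])
        obtain c where c: "c \<in> U (k e)" "d l c < r / 3" "c \<in> S"
          using l_cl[OF k(1)[of e]] r unfolding cl by (auto dest: spec[of _ "r / 3"])
        have "d c b < r / 3" using k(2)[of e] b c e unfolding small_def by fastforce
        then show ?thesis
          using triangle[of l c b] triangle[of l b a] commute[of a b] b c lS by auto
      qed
      then have "T closure_of U (k e) \<subseteq> U n" using r by blast
      then show "z n = 1" using z4[of n] k(1)[of e] by blast
    qed
    have "\<phi> l n = z n" for n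
      using z_U[of n] z1[of n] unfolding \<phi>_def by (cases "l \<in> U n"; simp)
    then have "\<phi> l = z" by (rule ext)
    then show ?thesis using lS by blast
  qed

  note measurable_coordinate[measurable]
  have coord: "{z :: nat \<Rightarrow> nat. z n \<in> A} \<in> sets borel" for n A
    using measurable_sets[OF measurable_coordinate, of A n] by (simp add: vimage_def)
  have G_borel[measurable]: "G \<in> sets borel"
  proof -
    \<comment> \<open>The common point ranges over a possibly uncountable space. Quantifying over
      the finitely many index sets \<open>I\<close> below \<open>N\<close> turns its existence into
      a constant and leaves conditions on finitely many digits.\<close>
    have "G = {z \<in> space borel. (\<forall>n. z n \<le> 1) \<and> (\<forall>e. \<exists>n. z n = 1 \<and> small e n) \<and>
      (\<forall>N. \<exists>I\<in>Pow {..<N}. (\<exists>x\<in>S. \<forall>n\<in>I. x \<in> U n) \<and> (\<forall>n<N. n \<in> I \<longleftrightarrow> z n = 1)) \<and>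
      (\<forall>n. z n = 1 \<longleftrightarrow> (\<exists>m. z m = 1 \<and> T closure_of U m \<subseteq> U n))}"
    proof -
      have "(\<exists>x\<in>S. \<forall>n<N. z n = 1 \<longrightarrow> x \<in> U n) \<longleftrightarrow>
        (\<exists>I\<in>Pow {..<N}. (\<exists>x\<in>S. \<forall>n\<in>I. x \<in> U n) \<and> (\<forall>n<N. n \<in> I \<longleftrightarrow> z n = 1))"
        (is "?L \<longleftrightarrow> ?R") for z :: "nat \<Rightarrow> nat" and N
      proof
        assume ?L
        then show ?R by (intro bexI[of _ "{n. n < N \<and> z n = 1}"]) auto
      next
        assume ?R
        then show ?L by blast
      qed
      then show ?thesis unfolding G_def by simp
    qed
    also have "\<dots> \<in> sets borel" by measurable
    finally show ?thesis .
  qed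

  define \<psi> where "\<psi> z = (if z \<in> G then inv_into S \<phi> z else x0)" for z
  have \<phi>_inj: "inj_on \<phi> S"
  proof (rule inj_onI)
    fix x y assume xy: "x \<in> S" "y \<in> S" "\<phi> x = \<phi> y"
    show "x = y"
    proof (rule ccontr)
      assume "x \<noteq> y"
      then have "d x y > 0" using xy by simp
      then obtain n where "x \<in> U n" "U n \<subseteq> mball x (d x y)" using U_ball xy(1) by blast
      moreover have "x \<in> U n \<longleftrightarrow> y \<in> U n" using fun_cong[OF xy(3), of n] unfolding \<phi>_def by (auto split: if_splits)
      ultimately show False by auto
    qed
  qed
  have \<psi>_\<phi>: "\<psi> (\<phi> x) = x" if "x \<in> S" for x
    unfolding \<psi>_def using \<phi>_G[OF that] \<phi>_inj that by simp
  have \<psi>_S: "\<psi> z \<in> S" for z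
    unfolding \<psi>_def using G_\<phi>[of z] x0 by (auto intro!: inv_into_into)
  have \<psi>_U: "\<psi> -` U n \<in> sets borel" for n
  proof -
    have "\<psi> -` U n = (G \<inter> {z. z n \<in> {1}}) \<union> (if x0 \<in> U n then - G else {})"
    proof -
      have "\<psi> z \<in> U n \<longleftrightarrow> z n = 1" if z: "z \<in> G" for z
      proof -
        obtain x where "x \<in> S" "\<phi> x = z" using G_\<phi>[OF z] by blast
        then show ?thesis using \<psi>_\<phi>[of x] \<phi>_def[of x n] by (auto split: if_splits)
      qed
      then show ?thesis by (auto simp: \<psi>_def split: if_splits)
    qed
    then show ?thesis using coord[of n "{1}"] G_borel by (auto intro: borel_comp)
  qed
  have "\<psi> \<in> borel \<rightarrow>\<^sub>M M"
  proof (rule measurable_sigma_sets[OF T(4)])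
    show "{U. openin T U} \<subseteq> Pow (space M)" using openin_subset T(1) by auto
    show "\<psi> \<in> space borel \<rightarrow> space M" using \<psi>_S S by auto
    fix W assume "W \<in> {U. openin T U}"
    then have "W = (\<Union>n\<in>{n. U n \<subseteq> W}. U n)" using U_basis by blast
    then have "\<psi> -` W = \<psi> -` (\<Union>n\<in>{n. U n \<subseteq> W}. U n)" by (rule arg_cong)
    then have "\<psi> -` W = (\<Union>n\<in>{n. U n \<subseteq> W}. \<psi> -` U n)" unfolding vimage_UN .
    then show "\<psi> -` W \<inter> space borel \<in> sets borel" using \<psi>_U by auto
  qed
  moreover have "\<phi> \<in> M \<rightarrow>\<^sub>M borel"
  proof (rule measurable_coordinatewise_then_product)
    fix n
    have "U n \<in> sets M" using U_open[of n] unfolding T(4) by auto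
    then show "(\<lambda>x. \<phi> x n) \<in> M \<rightarrow>\<^sub>M borel" unfolding \<phi>_def by measurable
  qed
  ultimately show ?thesis
    using \<psi>_\<phi> S by (intro exI[of _ \<phi>] exI[of _ \<psi>]) (auto simp: \<phi>_def)
qed

text \<open>The set is transported to binary sequences, which form a compact set, and finite
  sections are closed. Requiring points of \<open>Q'\<close> to be fixed by \<open>\<psi>\<close>
  followed by \<open>\<phi>\<close> leaves one code per point, so sections stay finite.\<close>

lemma standard_borel_projection_finite_sections:
  assumes "standard_borel M" and Q: "Q \<in> sets (M \<Otimes>\<^sub>M M)" "\<And>x. finite {y. (x, y) \<in> Q}"
  shows "fst ` Q \<in> sets M"
proof (cases "space M = {}")
  case True
  then have "Q = {}" using sets.sets_into_space[OF Q(1)] by (auto simp: space_pair_measure)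
  then show ?thesis by simp
next
  case False
  obtain \<phi> :: "'a \<Rightarrow> nat \<Rightarrow> nat" and \<psi> where
    [measurable]: "\<phi> \<in> M \<rightarrow>\<^sub>M borel" "\<psi> \<in> borel \<rightarrow>\<^sub>M M"
    and inv: "\<And>x. x \<in> space M \<Longrightarrow> \<psi> (\<phi> x) = x" "\<And>x n. x \<in> space M \<Longrightarrow> \<phi> x n \<le> 1"
    using standard_borel_embedding[OF assms(1) False] by blast
  have Qs: "x \<in> space M" "y \<in> space M" if "(x, y) \<in> Q" for x y
    using sets.sets_into_space[OF Q(1)] that by (auto simp: space_pair_measure)
  define Q' where "Q' = {p. (\<psi> (fst p), \<psi> (snd p)) \<in> Q \<and> \<phi> (\<psi> (fst p)) = fst p \<and> \<phi> (\<psi> (snd p)) = snd p}"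
  note Q(1)[measurable]
  define H where "H = {u. \<phi> (\<psi> u) = u}"
  have eq_borel: "{u \<in> space borel. f u = g u} \<in> sets borel"
    if [measurable]: "f \<in> borel \<rightarrow>\<^sub>M count_space UNIV" "g \<in> borel \<rightarrow>\<^sub>M count_space UNIV"
    for f g :: "(nat \<Rightarrow> nat) \<Rightarrow> nat"
    by measurable
  have "{u \<in> space borel. \<phi> (\<psi> u) n = u n} \<in> sets borel" for n
    by (intro eq_borel measurable_coordinate measurable_compose[OF _ measurable_coordinate]) measurable
  then have "(\<Inter>n. {u \<in> space borel. \<phi> (\<psi> u) n = u n}) \<in> sets borel" by auto
  also have "(\<Inter>n. {u \<in> space borel. \<phi> (\<psi> u) n = u n}) = H"
    unfolding H_def by (auto simp: fun_eq_iff)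
  finally have [measurable]: "H \<in> sets borel" .
  have "{p \<in> space (borel \<Otimes>\<^sub>M borel). (\<psi> (fst p), \<psi> (snd p)) \<in> Q \<and> fst p \<in> H \<and> snd p \<in> H}
        \<in> sets (borel \<Otimes>\<^sub>M borel)"
    by measurable
  then have "Q' \<in> sets borel" unfolding Q'_def H_def borel_prod by simp
  moreover have "Q' \<subseteq> UNIV \<times> {z. \<forall>n. z n \<le> 1}"
    unfolding Q'_def using inv(2) Qs by (auto, metis)
  moreover have "closed {y. (x, y) \<in> Q'}" for x
  proof (rule finite_imp_closed)
    have "{y. (x, y) \<in> Q'} \<subseteq> \<phi> ` {y. (\<psi> x, y) \<in> Q}"
      unfolding Q'_def by (auto, metis image_eqI mem_Collect_eq)
    then show "finite {y. (x, y) \<in> Q'}" using Q(2) finite_surj by blast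
  qed
  ultimately have "fst ` Q' \<in> sets borel"
    by (rule borel_projection_compact_sections[OF _ _ _ compact_binary_sequences])
  then have "\<phi> -` (fst ` Q') \<inter> space M \<in> sets M" by (rule measurable_sets[rotated]) measurable
  also have "\<phi> -` (fst ` Q') \<inter> space M = fst ` Q"
  proof (intro equalityI subsetI)
    fix x assume x: "x \<in> \<phi> -` (fst ` Q') \<inter> space M"
    then obtain y where "(\<phi> x, y) \<in> Q'" by force
    then have "(x, \<psi> y) \<in> Q" unfolding Q'_def using inv(1) x by auto
    then show "x \<in> fst ` Q" by force
  next
    fix x assume "x \<in> fst ` Q"
    then obtain y where xy: "(x, y) \<in> Q" by force
    then have "(\<phi> x, \<phi> y) \<in> Q'" unfolding Q'_def using inv(1) Qs[OF xy] by auto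
    then show "x \<in> \<phi> -` (fst ` Q') \<inter> space M" using Qs[OF xy] by force
  qed
  finally show ?thesis .
qed

section \<open>Measurable enumeration of finite sections\<close>

lemma standard_borel_countable_base:
  assumes "standard_borel M"
  shows "\<exists>U :: nat \<Rightarrow> 'a set. (\<forall>n. U n \<in> sets M) \<and>
    (\<forall>F x. finite F \<longrightarrow> F \<subseteq> space M \<longrightarrow> x \<in> space M \<longrightarrow> (\<exists>n. x \<in> U n \<and> U n \<inter> F \<subseteq> {x})) \<and>
    (\<forall>x\<in>space M. \<forall>y\<in>space M. x \<noteq> y \<longrightarrow> (\<exists>i j. x \<in> U i \<and> y \<in> U j \<and> U i \<inter> U j = {}))"
proof (cases "space M = {}")
  case True
  then show ?thesis by (intro exI[of _ "\<lambda>_. {}"]) auto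
next
  case False
  obtain \<phi> :: "'a \<Rightarrow> nat \<Rightarrow> nat" and \<psi> where \<phi>: "\<phi> \<in> M \<rightarrow>\<^sub>M borel"
    and inv: "\<And>x. x \<in> space M \<Longrightarrow> \<psi> (\<phi> x) = x"
    using standard_borel_embedding[OF assms False] by blast
  obtain V :: "nat \<Rightarrow> (nat \<Rightarrow> nat) set" where V: "\<And>n. open (V n)"
    "\<And>U y. open U \<Longrightarrow> y \<in> U \<Longrightarrow> \<exists>n. y \<in> V n \<and> V n \<subseteq> U"
    using ex_basis_sequence by metis
  define U where "U n = \<phi> -` V n \<inter> space M" for n
  have "U n \<in> sets M" for n
    unfolding U_def using V(1)[of n] by (intro measurable_sets[OF \<phi>]) auto
  moreover have "\<exists>n. x \<in> U n \<and> U n \<inter> F \<subseteq> {x}" if F: "finite F" "F \<subseteq> space M" "x \<in> space M" for F x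
  proof -
    have "open (- \<phi> ` (F - {x}))" using F(1) by (intro open_Compl finite_imp_closed) auto
    moreover have "\<phi> x \<in> - \<phi> ` (F - {x})" using inv F(2,3) by (auto, metis subsetD)
    ultimately obtain n where "\<phi> x \<in> V n" "V n \<subseteq> - \<phi> ` (F - {x})" using V(2) by metis
    then show ?thesis unfolding U_def using F(3) by (intro exI[of _ n]) auto
  qed
  moreover have "\<exists>i j. x \<in> U i \<and> y \<in> U j \<and> U i \<inter> U j = {}"
    if xy: "x \<in> space M" "y \<in> space M" "x \<noteq> y" for x y
  proof -
    have "\<phi> x \<noteq> \<phi> y" using inv xy by metis
    from hausdorff[OF this] obtain A B
      where AB: "open A" "open B" "\<phi> x \<in> A" "\<phi> y \<in> B" "A \<inter> B = {}" by blast
    obtain i where i: "\<phi> x \<in> V i" "V i \<subseteq> A" using V(2)[OF AB(1,3)] by blast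
    obtain j where j: "\<phi> y \<in> V j" "V j \<subseteq> B" using V(2)[OF AB(2,4)] by blast
    have "V i \<inter> V j = {}" using i(2) j(2) AB(5) by blast
    then have "U i \<inter> U j = {}" unfolding U_def by blast
    then show ?thesis unfolding U_def using i(1) j(1) xy(1,2) by auto
  qed
  ultimately show ?thesis by (intro exI[of _ U] conjI allI ballI impI)
qed

text \<open>
  The selectors pick the element of a section lying in a basic set, at the points where it is
  unique; every element of a finite section is isolated by some basic set.
\<close>

lemma ex_measurable_selectors:
  assumes M: "standard_borel M" and Q: "Q \<in> sets (M \<Otimes>\<^sub>M M)" "\<And>x. finite {y. (x, y) \<in> Q}"
  shows "\<exists>f :: nat \<Rightarrow> 'a \<Rightarrow> 'a. (\<forall>n. f n \<in> M \<rightarrow>\<^sub>M M) \<and> (\<forall>x y. (x, y) \<in> Q \<longrightarrow> (\<exists>n. f n x = y))"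
proof -
  obtain U :: "nat \<Rightarrow> 'a set" where U: "\<And>n. U n \<in> sets M"
    "\<And>F x. finite F \<Longrightarrow> F \<subseteq> space M \<Longrightarrow> x \<in> space M \<Longrightarrow> \<exists>n. x \<in> U n \<and> U n \<inter> F \<subseteq> {x}"
    "\<And>x y. x \<in> space M \<Longrightarrow> y \<in> space M \<Longrightarrow> x \<noteq> y \<Longrightarrow> \<exists>i j. x \<in> U i \<and> y \<in> U j \<and> U i \<inter> U j = {}"
    using standard_borel_countable_base[OF M] by metis
  have Qs: "x \<in> space M" "y \<in> space M" if "(x, y) \<in> Q" for x y
    using sets.sets_into_space[OF Q(1)] that by (auto simp: space_pair_measure)
  define P where "P B = fst ` (Q \<inter> (space M \<times> B))" for B
  have P_iff: "x \<in> P B \<longleftrightarrow> (\<exists>y\<in>B. (x, y) \<in> Q)" for x B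
    unfolding P_def using Qs by force
  have P: "P B \<in> sets M" if "B \<in> sets M" for B
    unfolding P_def
  proof (rule standard_borel_projection_finite_sections[OF M])
    show "Q \<inter> (space M \<times> B) \<in> sets (M \<Otimes>\<^sub>M M)" using Q(1) that by auto
    show "finite {y. (x, y) \<in> Q \<inter> (space M \<times> B)}" for x
      by (rule finite_subset[OF _ Q(2)[of x]]) auto
  qed
  \<comment> \<open>\<open>D n\<close> is to be the set where exactly one element of the section
    lies in \<open>U n\<close>. Uniqueness fails precisely if two disjoint basic sets both meet that
    piece of the section, which is a countable condition on Borel projections.\<close>
  define D where "D n = P (U n) -
    (\<Union>(i, j)\<in>{(i, j). U i \<inter> U j = {}}. P (U n \<inter> U i) \<inter> P (U n \<inter> U j))" for n
  have D: "D n \<in> sets M" for n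
    unfolding D_def using U(1) P by (intro sets.Diff sets.countable_UN'') auto
  have D_ex1: "x \<in> D n \<longleftrightarrow> (\<exists>!y. y \<in> U n \<and> (x, y) \<in> Q)" for x n
  proof
    assume x: "x \<in> D n"
    then have "x \<in> P (U n)" unfolding D_def by (rule DiffD1)
    then obtain y where y: "y \<in> U n" "(x, y) \<in> Q" unfolding P_iff by blast
    have "y' = y" if y': "y' \<in> U n" "(x, y') \<in> Q" for y'
    proof (rule ccontr)
      assume "y' \<noteq> y"
      then obtain i j where ij: "y' \<in> U i" "y \<in> U j" "U i \<inter> U j = {}"
        using U(3)[OF Qs(2)[OF y'(2)] Qs(2)[OF y(2)]] by blast
      have "x \<in> P (U n \<inter> U i)" unfolding P_iff using ij(1) y' by blast
      moreover have "x \<in> P (U n \<inter> U j)" unfolding P_iff using ij(2) y by blast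
      ultimately show False using x ij(3) unfolding D_def by blast
    qed
    then show "\<exists>!y. y \<in> U n \<and> (x, y) \<in> Q" using y by blast
  next
    assume "\<exists>!y. y \<in> U n \<and> (x, y) \<in> Q"
    then obtain y where y: "y \<in> U n" "(x, y) \<in> Q" "\<And>y'. y' \<in> U n \<Longrightarrow> (x, y') \<in> Q \<Longrightarrow> y' = y"
      by blast
    have no: "x \<notin> P (U n \<inter> U i) \<inter> P (U n \<inter> U j)" if ij: "U i \<inter> U j = {}" for i j
    proof
      assume "x \<in> P (U n \<inter> U i) \<inter> P (U n \<inter> U j)"
      then obtain a b where "a \<in> U n \<inter> U i" "(x, a) \<in> Q" "b \<in> U n \<inter> U j" "(x, b) \<in> Q"
        unfolding P_iff Int_iff by auto
      then have "y \<in> U i \<inter> U j" using y(3)[of a] y(3)[of b] by auto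
      then show False using ij by blast
    qed
    have "x \<in> P (U n)" unfolding P_iff using y(1,2) by (rule bexI[rotated])
    then show "x \<in> D n" unfolding D_def using no by (intro DiffI) auto
  qed
  \<comment> \<open>Off \<open>D n\<close> the identity is the default, which keeps the selector
    total and measurable.\<close>
  define f where "f n x = (if x \<in> D n then THE y. y \<in> U n \<and> (x, y) \<in> Q else x)" for n x
  have f_D: "f n x \<in> U n \<and> (x, f n x) \<in> Q" if "x \<in> D n" for n x
    using theI'[OF that[unfolded D_ex1]] that unfolding f_def by simp
  have "f n \<in> M \<rightarrow>\<^sub>M M" for n
  proof (rule measurableI)
    show "f n x \<in> space M" if "x \<in> space M" for x
      using f_D[of x n] Qs that by (cases "x \<in> D n") (auto simp: f_def)
    fix B assume B: "B \<in> sets M"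
    have f_in_D: "f n x \<in> B \<longleftrightarrow> x \<in> P (U n \<inter> B)" if "x \<in> D n" for x
    proof -
      have "y = f n x" if "y \<in> U n" "(x, y) \<in> Q" for y
        using f_D[OF \<open>x \<in> D n\<close>] \<open>x \<in> D n\<close> that unfolding D_ex1 by blast
      then show ?thesis using f_D[OF that] unfolding P_iff by blast
    qed
    have "f n -` B \<inter> space M = (D n \<inter> P (U n \<inter> B)) \<union> (B - D n)"
    proof (rule set_eqI)
      fix x
      show "x \<in> f n -` B \<inter> space M \<longleftrightarrow> x \<in> (D n \<inter> P (U n \<inter> B)) \<union> (B - D n)"
      proof (cases "x \<in> D n")
        case True
        then show ?thesis using f_in_D[OF True] sets.sets_into_space[OF D[of n]] by blast
      next
        case False
        then have "f n x = x" unfolding f_def by simp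
        then show ?thesis using False sets.sets_into_space[OF B] by auto
      qed
    qed
    also have "\<dots> \<in> sets M" using D P U(1) B by auto
    finally show "f n -` B \<inter> space M \<in> sets M" .
  qed
  moreover have "\<exists>n. f n x = y" if xy: "(x, y) \<in> Q" for x y
  proof -
    have "{y. (x, y) \<in> Q} \<subseteq> space M" using Qs by blast
    then obtain n where n: "y \<in> U n" "U n \<inter> {y. (x, y) \<in> Q} \<subseteq> {y}"
      using U(2)[OF Q(2)[of x]] Qs[OF xy] by blast
    then have "x \<in> D n" unfolding D_ex1 using xy by blast
    then show ?thesis using f_D[of x n] n(2) by blast
  qed
  ultimately show ?thesis by blast
qed


section \<open>Coarsening along a sequence of scales\<close>

lemma iterate_control:
  fixes N :: "nat \<Rightarrow> nat \<Rightarrow> 'a \<Rightarrow> 'a \<Rightarrow> bool"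
  assumes "\<And>m t. \<exists>t'. \<forall>x y. N m t x y \<longrightarrow> N (Suc m) t' x y" and "m \<le> n"
  shows "\<exists>t'. \<forall>x y. N m t x y \<longrightarrow> N n t' x y"
  using assms(2)
proof (induction n)
  case (Suc n)
  show ?case
  proof (cases "m = Suc n")
    case False
    then obtain t' where "\<forall>x y. N m t x y \<longrightarrow> N n t' x y" using Suc by auto
    then show ?thesis using assms(1)[of n t'] by blast
  qed auto
qed auto

text \<open>
  \<open>N m t x y\<close> stands for \<open>\<rho>\<^bsub>m\<^esub> x y \<le> t\<close>. The number \<open>d (Suc m) + 2\<close> in \<open>r_eq\<close> bounds the number of
  indices that separate points near a given \<open>F m\<close>-class.
\<close>

locale scales =
  fixes X :: "'a set" and N :: "nat \<Rightarrow> nat \<Rightarrow> 'a \<Rightarrow> 'a \<Rightarrow> bool" and F :: "nat \<Rightarrow> 'a \<Rightarrow> 'a \<Rightarrow> bool"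
    and d w b r :: "nat \<Rightarrow> nat"
  assumes N_refl: "x \<in> X \<Longrightarrow> N m t x x"
    and N_sym: "N m t x y \<Longrightarrow> N m t y x"
    and N_trans: "N m s x y \<Longrightarrow> N m t y z \<Longrightarrow> N m (s + t) x z"
    and N_mono: "N m s x y \<Longrightarrow> s \<le> t \<Longrightarrow> N m t x y"
    and N_X: "N m t x y \<Longrightarrow> x \<in> X"
    and N_finite: "finite {y. N m t x y}"
    and N_Suc: "\<exists>t'. \<forall>x y. N m t x y \<longrightarrow> N (Suc m) t' x y"
    and F_refl: "x \<in> X \<Longrightarrow> F m x x"
    and F_sym: "F m x y \<Longrightarrow> F m y x"
    and F_trans: "F m x y \<Longrightarrow> F m y z \<Longrightarrow> F m x z"
    and F_N: "F m x y \<Longrightarrow> N m (b m) x y"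
    and F_classes: "x \<in> X \<Longrightarrow> finite {C. \<exists>y. N m (r m) x y \<and> C = {z. F m y z}}"
      "x \<in> X \<Longrightarrow> card {C. \<exists>y. N m (r m) x y \<and> C = {z. F m y z}} \<le> d m + 1"
    and r_eq: "r m = (2 * (d (Suc m) + 2) + 2) * w m"
    and expand: "N m (2 * r m + 3 * b m + w m) x y \<Longrightarrow> N (Suc m) (w (Suc m)) x y"
begin

lemma N_trans_le: "N m s x y \<Longrightarrow> N m t y z \<Longrightarrow> s + t \<le> u \<Longrightarrow> N m u x z"
  using N_trans N_mono by blast

lemma shell_radius_le: "j \<le> d (Suc m) + 2 \<Longrightarrow> (2 * j + 2) * w m \<le> r m"
  by (subst r_eq, intro mult_le_mono1) simp

section \<open>Balls around cells and one coarsening step\<close>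

definition near :: "nat \<Rightarrow> nat \<Rightarrow> 'a \<Rightarrow> 'a \<Rightarrow> bool" where
  "near m t x z \<longleftrightarrow> (\<exists>z'. F m z z' \<and> N m t x z')"

text \<open>
  \<open>Q n\<close> is the relation with index \<open>n\<close> at level \<open>Suc m\<close>; it is active at the cell of \<open>z\<close> if it
  separates points near that cell.
\<close>

definition active :: "nat \<Rightarrow> (nat \<Rightarrow> 'a \<Rightarrow> 'a \<Rightarrow> bool) \<Rightarrow> nat \<Rightarrow> 'a \<Rightarrow> bool" where
  "active m Q n z \<longleftrightarrow> (\<exists>z' u v. F m z z' \<and> N m (2 * r m + 2 * b m + w m) z' u \<and>
     N m (2 * r m + 2 * b m + w m) z' v \<and> \<not> Q n u v)"

text \<open>Distinct indices active at the same cell have distinct ranks, and ranks admit a bound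
  independent of \<open>n\<close>.\<close>

definition rank :: "nat \<Rightarrow> (nat \<Rightarrow> 'a \<Rightarrow> 'a \<Rightarrow> bool) \<Rightarrow> nat \<Rightarrow> 'a \<Rightarrow> nat" where
  "rank m Q n z = card {n' \<in> {m<..<n}. active m Q n' z}"

text \<open>With rank \<open>j\<close> the radius is the odd multiple \<open>2 * j + 1\<close> of
  \<open>w m\<close>. If a move of length at most \<open>w m\<close> crosses the sphere, its
  endpoints are further than \<open>2 * j * w m\<close> and at most \<open>(2 * j + 2) * w m\<close>
  from the cell. These half-open ranges are disjoint for different ranks.\<close>

definition shell :: "nat \<Rightarrow> (nat \<Rightarrow> 'a \<Rightarrow> 'a \<Rightarrow> bool) \<Rightarrow> nat \<Rightarrow> 'a \<Rightarrow> 'a \<Rightarrow> bool" where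
  "shell m Q n x z \<longleftrightarrow> near m ((2 * rank m Q n z + 1) * w m) x z"

definition part :: "nat \<Rightarrow> (nat \<Rightarrow> 'a \<Rightarrow> 'a \<Rightarrow> bool) \<Rightarrow> nat \<Rightarrow> 'a \<Rightarrow> 'a \<Rightarrow> bool" where
  "part m Q n x y \<longleftrightarrow> x \<in> X \<and> y \<in> X \<and> (\<forall>z. shell m Q n x z \<longleftrightarrow> shell m Q n y z)"

text \<open>Points are related if their parts meet the same \<open>Q n\<close>-classes. This is an
  equivalence relation containing \<open>part\<close>, obtained without a transitive closure, so
  classes grow by no more than a part.\<close>

definition step :: "nat \<Rightarrow> (nat \<Rightarrow> 'a \<Rightarrow> 'a \<Rightarrow> bool) \<Rightarrow> nat \<Rightarrow> 'a \<Rightarrow> 'a \<Rightarrow> bool" where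
  "step m Q n x y \<longleftrightarrow> x \<in> X \<and> y \<in> X \<and>
     (\<forall>x'. part m Q n x x' \<longrightarrow> (\<exists>y'. part m Q n y y' \<and> Q n x' y')) \<and>
     (\<forall>y'. part m Q n y y' \<longrightarrow> (\<exists>x'. part m Q n x x' \<and> Q n x' y'))"

section \<open>Descending recursion over the levels\<close>

lemma step_cong:
  assumes "\<And>n'. m < n' \<Longrightarrow> n' \<le> n \<Longrightarrow> Q n' = Q' n'" "m < n"
  shows "step m Q n = step m Q' n"
proof -
  have "rank m Q n z = rank m Q' n z" for z
  proof -
    have "active m Q n' z \<longleftrightarrow> active m Q' n' z" if "n' \<in> {m<..<n}" for n'
      unfolding active_def using assms(1)[of n'] that by simp
    then show ?thesis unfolding rank_def by (metis (mono_tags, lifting) Collect_cong)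
  qed
  then have "part m Q n = part m Q' n" unfolding part_def shell_def by (intro ext) simp
  then show ?thesis unfolding step_def using assms by (intro ext) simp
qed

text \<open>Level \<open>m\<close> at index \<open>n\<close> calls level \<open>Suc m\<close> at all
  indices from \<open>Suc m\<close> to \<open>n\<close>. The first argument is fuel that makes this
  recursion primitive; \<open>n - m\<close> units suffice and more change nothing, so
  \<open>R\<close> may supply \<open>n\<close>.\<close>

primrec H :: "nat \<Rightarrow> nat \<Rightarrow> nat \<Rightarrow> 'a \<Rightarrow> 'a \<Rightarrow> bool" where
  "H 0 m n = (\<lambda>x y. x \<in> X \<and> x = y)"
| "H (Suc K) m n = (if n \<le> m then (\<lambda>x y. x \<in> X \<and> x = y) else step m (H K (Suc m)) n)"

lemma H_Suc: "n \<le> m + K \<Longrightarrow> H (Suc K) m n = H K m n"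
proof (induction K arbitrary: m n)
  case (Suc K)
  have "step m (H (Suc K) (Suc m)) n = step m (H K (Suc m)) n" if "m < n"
    using that Suc.prems by (intro step_cong Suc.IH) auto
  then show ?case by simp
qed simp

lemma H_eq: "n \<le> m + K \<Longrightarrow> K \<le> K' \<Longrightarrow> H K' m n = H K m n"
proof (induction K')
  case (Suc K')
  then show ?case using H_Suc[of n m K'] by (cases "K = Suc K'") auto
qed simp

definition R :: "nat \<Rightarrow> nat \<Rightarrow> 'a \<Rightarrow> 'a \<Rightarrow> bool" where
  "R m n = H n m n"

lemma R_id: "n \<le> m \<Longrightarrow> R m n = (\<lambda>x y. x \<in> X \<and> x = y)"
  unfolding R_def by (cases n) auto

lemma R_step: assumes "m < n" shows "R m n = step m (R (Suc m)) n"
proof -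
  obtain k where k: "n = Suc k" using assms by (cases n) auto
  have "step m (H k (Suc m)) n = step m (R (Suc m)) n"
  proof (rule step_cong[OF _ assms])
    fix n' assume n': "m < n'" "n' \<le> n"
    have "H k (Suc m) n' = H (n' - Suc m) (Suc m) n'" using n' k by (intro H_eq) auto
    moreover have "H n' (Suc m) n' = H (n' - Suc m) (Suc m) n'" using n' by (intro H_eq) auto
    ultimately show "H k (Suc m) n' = R (Suc m) n'" unfolding R_def by simp
  qed
  then show ?thesis using assms k unfolding R_def by simp
qed

lemma part_refl: "x \<in> X \<Longrightarrow> part m Q n x x"
  and part_sym: "part m Q n x y \<Longrightarrow> part m Q n y x"
  and part_trans: "part m Q n x y \<Longrightarrow> part m Q n y z \<Longrightarrow> part m Q n x z"
  and part_X: "part m Q n x y \<Longrightarrow> x \<in> X \<and> y \<in> X"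
  unfolding part_def by auto

lemma step_equiv:
  assumes refl: "\<And>x. x \<in> X \<Longrightarrow> Q n x x" and sym: "\<And>x y. Q n x y \<Longrightarrow> Q n y x"
    and trans: "\<And>x y z. Q n x y \<Longrightarrow> Q n y z \<Longrightarrow> Q n x z"
  shows "x \<in> X \<Longrightarrow> step m Q n x x"
    and "step m Q n x y \<Longrightarrow> step m Q n y x"
    and "step m Q n x y \<Longrightarrow> step m Q n y z \<Longrightarrow> step m Q n x z"
proof -
  show "x \<in> X \<Longrightarrow> step m Q n x x"
    unfolding step_def using refl part_X by blast
  show "step m Q n x y \<Longrightarrow> step m Q n y x"
    unfolding step_def using sym by blast
  show "step m Q n x y \<Longrightarrow> step m Q n y z \<Longrightarrow> step m Q n x z"
    unfolding step_def by (meson trans)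
qed

lemma
  shows R_refl: "x \<in> X \<Longrightarrow> R m n x x"
    and R_sym: "R m n x y \<Longrightarrow> R m n y x"
    and R_trans: "R m n x y \<Longrightarrow> R m n y z \<Longrightarrow> R m n x z"
proof -
  have "(\<forall>x. x \<in> X \<longrightarrow> R m n x x) \<and> (\<forall>x y. R m n x y \<longrightarrow> R m n y x) \<and>
    (\<forall>x y z. R m n x y \<longrightarrow> R m n y z \<longrightarrow> R m n x z)"
  proof (induction "n - m" arbitrary: m)
    case 0
    then show ?case by (auto simp: R_id)
  next
    case (Suc k)
    then have mn: "m < n" and k: "k = n - Suc m" by auto
    note IH = Suc.hyps(1)[OF k]
    show ?case
      unfolding R_step[OF mn]
      using step_equiv[of "R (Suc m)" n, OF IH[THEN conjunct1, rule_format]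
          IH[THEN conjunct2, THEN conjunct1, rule_format] IH[THEN conjunct2, THEN conjunct2, rule_format]]
      by (intro conjI allI impI)
  qed
  then show "x \<in> X \<Longrightarrow> R m n x x" "R m n x y \<Longrightarrow> R m n y x"
    "R m n x y \<Longrightarrow> R m n y z \<Longrightarrow> R m n x z" by blast+
qed

lemma F_X: "F m x y \<Longrightarrow> x \<in> X \<and> y \<in> X"
  using F_N N_X N_sym by blast

lemma near_F: "F m z z' \<Longrightarrow> near m t x z \<longleftrightarrow> near m t x z'"
  unfolding near_def using F_sym F_trans by blast

lemma active_F: "F m z z' \<Longrightarrow> active m Q n z \<longleftrightarrow> active m Q n z'"
  unfolding active_def using F_sym F_trans by blast

lemma near_X: "near m t x z \<Longrightarrow> z \<in> X"
  unfolding near_def using F_X by blast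

lemma near_mono: "near m s x z \<Longrightarrow> s \<le> t \<Longrightarrow> near m t x z"
  unfolding near_def using N_mono by blast

lemma near_trans: "N m s x y \<Longrightarrow> near m t y z \<Longrightarrow> s + t \<le> u \<Longrightarrow> near m u x z"
  unfolding near_def using N_trans_le by blast

section \<open>Counting the indices that cut at a point\<close>

definition cut :: "nat \<Rightarrow> nat \<Rightarrow> 'a \<Rightarrow> bool" where
  "cut m n x \<longleftrightarrow> (\<exists>y. N m (w m) x y \<and> \<not> R m n x y)"

text \<open>The passage from level \<open>m\<close> to level \<open>Suc m\<close>: by
  \<open>expand\<close> all points tested by \<open>active\<close> lie within
  \<open>w (Suc m)\<close> of \<open>z\<close>, and \<open>z\<close> cannot be related to both
  separated points.\<close>

lemma active_imp_cut:
  assumes "active m (R (Suc m)) n z"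
  shows "cut (Suc m) n z"
proof -
  obtain z' u v where z': "F m z z'" and uv: "N m (2 * r m + 2 * b m + w m) z' u"
    "N m (2 * r m + 2 * b m + w m) z' v" "\<not> R (Suc m) n u v"
    using assms unfolding active_def by blast
  \<comment> \<open>Moving from \<open>z\<close> to \<open>z'\<close> inside the cell costs one more
    \<open>b m\<close>, whence the \<open>3 * b m\<close> in \<open>expand\<close>.\<close>
  have "N (Suc m) (w (Suc m)) z u" "N (Suc m) (w (Suc m)) z v"
    using N_trans_le[OF F_N[OF z'] uv(1)] N_trans_le[OF F_N[OF z'] uv(2)] by (auto intro!: expand)
  moreover have "\<not> R (Suc m) n z u \<or> \<not> R (Suc m) n z v" using R_sym R_trans uv(3) by blast
  ultimately show ?thesis unfolding cut_def by blast
qed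

text \<open>Cuts at level \<open>Suc m\<close> are counted only for indices above
  \<open>Suc m\<close>. The index \<open>Suc m\<close>, whose relation at that level is equality,
  may also be active; it accounts for the extra unit and so for the \<open>d (Suc m) + 2\<close> in
  \<open>r m\<close>.\<close>

lemma rank_le_card_cut:
  assumes "n \<le> L"
  shows "rank m (R (Suc m)) n z \<le> Suc (card {n'. Suc m < n' \<and> n' \<le> L \<and> cut (Suc m) n' z})"
proof -
  have "{n' \<in> {m<..<n}. active m (R (Suc m)) n' z} \<subseteq>
      insert (Suc m) {n'. Suc m < n' \<and> n' \<le> L \<and> cut (Suc m) n' z}"
    using active_imp_cut assms by auto
  then have "rank m (R (Suc m)) n z \<le> card (insert (Suc m) {n'. Suc m < n' \<and> n' \<le> L \<and> cut (Suc m) n' z})"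
    unfolding rank_def by (intro card_mono) auto
  also have "\<dots> \<le> Suc (card {n'. Suc m < n' \<and> n' \<le> L \<and> cut (Suc m) n' z})"
    by (rule card_insert_le_m1) auto
  finally show ?thesis .
qed

text \<open>A point lies in the ball around its own cell, hence so does its whole part. The rank
  bound is a hypothesis because the lemma is already used inside the induction that establishes
  it.\<close>

lemma part_N:
  assumes rank: "\<And>z. z \<in> X \<Longrightarrow> rank m Q n z \<le> d (Suc m) + 2" and "part m Q n x y"
  shows "N m (r m + b m) x y"
proof -
  have X: "x \<in> X" "y \<in> X" using part_X[OF assms(2)] by auto
  have "shell m Q n x x"
    unfolding shell_def near_def using F_refl N_refl X(1) by blast
  then have "shell m Q n y x" using assms(2) unfolding part_def by blast
  then obtain z where z: "F m x z" "N m ((2 * rank m Q n x + 1) * w m) y z"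
    unfolding shell_def near_def by blast
  have "(2 * rank m Q n x + 1) * w m \<le> r m"
    using shell_radius_le[OF rank[OF X(1)]] by (simp add: algebra_simps)
  then show ?thesis using N_trans_le[OF F_N[OF z(1)] N_sym[OF z(2)]] by simp
qed

text \<open>
  A cut at \<open>x\<close> comes from a cell whose distance to \<open>x\<close> lies in an interval determined by the rank
  of \<open>n\<close> at that cell. Active indices have different ranks at the same cell, so \<open>n\<close> is
  determined by the cell.
\<close>

lemma card_cut_le:
  "x \<in> X \<Longrightarrow> card {n. m < n \<and> n \<le> L \<and> cut m n x} \<le> d m + 1"
proof (induction "L - m" arbitrary: m x)
  case 0
  then have "{n. m < n \<and> n \<le> L \<and> cut m n x} = {}" by auto
  then show ?case by (simp only: card.empty)
next
  case (Suc k)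
  let ?Q = "R (Suc m)"
  let ?A = "{n. m < n \<and> n \<le> L \<and> cut m n x}"
  have rank: "rank m ?Q n z \<le> d (Suc m) + 2" if "n \<le> L" "z \<in> X" for n z
  proof -
    have "k = L - Suc m" using Suc.hyps(2) by arith
    from Suc.hyps(1)[OF this that(2)] show ?thesis
      using rank_le_card_cut[OF that(1), of m z] by simp
  qed
  have ex: "\<exists>z. active m ?Q n z \<and> near m ((2 * rank m ?Q n z + 2) * w m) x z \<and>
      \<not> near m (2 * rank m ?Q n z * w m) x z" if n: "n \<in> ?A" for n
  proof -
    have mn: "m < n" and nL: "n \<le> L" using n by auto
    obtain y where y: "N m (w m) x y" "\<not> R m n x y" using n unfolding cut_def by blast
    have yX: "y \<in> X" using N_X N_sym y(1) by blast
    have part_near: "N m (r m + b m) a a'" if "part m ?Q n a a'" for a a'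
      using part_N[OF rank[OF nL] that] .
    have "\<not> part m ?Q n x y"
    proof
      assume "part m ?Q n x y"
      then have "step m ?Q n x y"
        unfolding step_def using part_sym part_trans part_X R_refl by meson
      then show False using y(2) R_step[OF mn] by simp
    qed
    then obtain z where z: "shell m ?Q n x z \<noteq> shell m ?Q n y z"
      unfolding part_def using Suc.prems yX by blast
    define j where "j = rank m ?Q n z"
    \<comment> \<open>Exactly one of \<open>x\<close> and \<open>y\<close> lies in the ball of
      radius \<open>(2 * j + 1) * w m\<close>, and they are at most \<open>w m\<close>
      apart.\<close>
    have near1: "near m ((2 * j + 2) * w m) x z" and near2: "\<not> near m (2 * j * w m) x z"
      using z near_mono[of m "(2 * j + 1) * w m" x z "(2 * j + 2) * w m"]
        near_mono[of m "2 * j * w m" x z "(2 * j + 1) * w m"]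
        near_trans[OF y(1), of "(2 * j + 1) * w m" z "(2 * j + 2) * w m"]
        near_trans[OF N_sym[OF y(1)], of "2 * j * w m" z "(2 * j + 1) * w m"]
      unfolding shell_def j_def[symmetric] by auto
    have "(2 * j + 2) * w m \<le> r m"
      unfolding j_def by (rule shell_radius_le[OF rank[OF nL near_X[OF near1]]])
    then obtain z' where z': "F m z z'" "N m (r m) x z'"
      using near_mono[OF near1] unfolding near_def by blast
    \<comment> \<open>An inactive \<open>n\<close> relates all points around the cell, in particular
      those of the part of \<open>x\<close> to those of the part of \<open>y\<close>, so
      \<open>step\<close> would join \<open>x\<close> and \<open>y\<close>.\<close>
    have "active m ?Q n z"
    proof (rule ccontr)
      assume "\<not> active m ?Q n z"
      then have Q: "?Q n u v" if "N m (2 * r m + 2 * b m + w m) z' u" "N m (2 * r m + 2 * b m + w m) z' v" for u v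
        using that z'(1) unfolding active_def by blast
      have z'x: "N m (r m) z' x" by (rule N_sym[OF z'(2)])
      have z'y: "N m (r m + w m) z' y" by (rule N_trans[OF z'x y(1)])
      \<comment> \<open>Origin of the radius in \<open>active\<close>: \<open>r m\<close> from
        \<open>z'\<close> to \<open>x\<close>, \<open>w m\<close> more to \<open>y\<close>, and
        \<open>r m + b m\<close> within a part.\<close>
      have x': "N m (2 * r m + 2 * b m + w m) z' x'" if "part m ?Q n x x'" for x'
        by (rule N_trans_le[OF z'x part_near[OF that]]) simp
      have y': "N m (2 * r m + 2 * b m + w m) z' y'" if "part m ?Q n y y'" for y'
        by (rule N_trans_le[OF z'y part_near[OF that]]) simp
      have "step m ?Q n x y"
        unfolding step_def
      proof (intro conjI allI impI)
        show "\<exists>y'. part m ?Q n y y' \<and> ?Q n x' y'" if "part m ?Q n x x'" for x'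
          using part_refl[OF yX] Q[OF x'[OF that] y'] by blast
        show "\<exists>x'. part m ?Q n x x' \<and> ?Q n x' y'" if "part m ?Q n y y'" for y'
          using part_refl[OF Suc.prems] Q[OF x' y'[OF that]] by blast
      qed (rule Suc.prems yX)+
      then show False using y(2) R_step[OF mn] by simp
    qed
    then show ?thesis using near1 near2 unfolding j_def by blast
  qed
  have "\<forall>n\<in>?A. \<exists>z. active m ?Q n z \<and> near m ((2 * rank m ?Q n z + 2) * w m) x z \<and>
      \<not> near m (2 * rank m ?Q n z * w m) x z"
    using ex by blast
  from bchoice[OF this] obtain z where z': "\<forall>n\<in>?A. active m ?Q n (z n) \<and>
      near m ((2 * rank m ?Q n (z n) + 2) * w m) x (z n) \<and>
      \<not> near m (2 * rank m ?Q n (z n) * w m) x (z n)" ..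
  have z: "active m ?Q n (z n)" "near m ((2 * rank m ?Q n (z n) + 2) * w m) x (z n)"
    "\<not> near m (2 * rank m ?Q n (z n) * w m) x (z n)" if "n \<in> ?A" for n
    using z'[rule_format, OF that] by auto
  let ?C = "{C. \<exists>y. N m (r m) x y \<and> C = {z. F m y z}}"
  let ?g = "\<lambda>n. {z'. F m (z n) z'}"
  have "?g ` ?A \<subseteq> ?C"
  proof
    fix C assume "C \<in> ?g ` ?A"
    then obtain n where n: "n \<in> ?A" "C = ?g n" by blast
    have "(2 * rank m ?Q n (z n) + 2) * w m \<le> r m"
      using n(1) by (intro shell_radius_le rank[OF _ near_X[OF z(2)[OF n(1)]]]) simp
    then obtain z' where "F m (z n) z'" "N m (r m) x z'"
      using near_mono[OF z(2)[OF n(1)]] unfolding near_def by blast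
    then show "C \<in> ?C" using n(2) F_sym F_trans by blast
  qed
  moreover have "inj_on ?g ?A"
  proof -
    \<comment> \<open>At a common cell the smaller index is counted in the rank of the larger one,
      so the two ranges for the distance to \<open>x\<close> are disjoint.\<close>
    have less: False if n: "n1 \<in> ?A" "n2 \<in> ?A" "n1 < n2" "?g n1 = ?g n2" for n1 n2
    proof -
      have "F m (z n2) (z n2)" using F_refl near_X[OF z(2)[OF n(2)]] .
      then have F: "F m (z n1) (z n2)" using n(4) by blast
      let ?a = "\<lambda>n z. {n' \<in> {m<..<n}. active m ?Q n' z}"
      have "insert n1 (?a n1 (z n1)) \<subseteq> ?a n2 (z n2)"
      proof
        fix n' assume "n' \<in> insert n1 (?a n1 (z n1))"
        then have "m < n' \<and> n' < n2 \<and> active m ?Q n' (z n1)" using n(1,3) z(1)[OF n(1)] by auto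
        then show "n' \<in> ?a n2 (z n2)" using active_F[OF F] by simp
      qed
      then have "card (insert n1 (?a n1 (z n1))) \<le> card (?a n2 (z n2))"
        by (intro card_mono) auto
      then have "Suc (rank m ?Q n1 (z n1)) \<le> rank m ?Q n2 (z n2)"
        unfolding rank_def by (subst (asm) card_insert_disjoint) auto
      then have "(2 * rank m ?Q n1 (z n1) + 2) * w m \<le> 2 * rank m ?Q n2 (z n2) * w m"
        by (intro mult_le_mono1) simp
      then show False using near_mono[OF z(2)[OF n(1)]] z(3)[OF n(2)] near_F[OF F] by blast
    qed
    show ?thesis
    proof (rule inj_onI)
      fix n1 n2 assume "n1 \<in> ?A" "n2 \<in> ?A" "?g n1 = ?g n2"
      then show "n1 = n2" using less[of n1 n2] less[of n2 n1] by (cases n1 n2 rule: linorder_cases) simp_all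
    qed
  qed
  ultimately have "card ?A \<le> card ?C" using F_classes(1)[OF Suc.prems] by (intro card_inj_on_le)
  then show ?case using F_classes(2)[OF Suc.prems, of m] by linarith
qed

text \<open>The truncation at \<open>L\<close> gives the preceding induction its start. Its bound is
  independent of \<open>L\<close>, so it applies to any \<open>d m + 2\<close> cutting indices with
  their maximum as \<open>L\<close>.\<close>

lemma finite_cut: "x \<in> X \<Longrightarrow> finite {n. m < n \<and> cut m n x}"
proof (rule ccontr)
  assume x: "x \<in> X" and "infinite {n. m < n \<and> cut m n x}"
  then obtain S where S: "S \<subseteq> {n. m < n \<and> cut m n x}" "card S = d m + 2" "finite S"
    using infinite_arbitrarily_large by metis
  then have "S \<subseteq> {n. m < n \<and> n \<le> Max S \<and> cut m n x}" by auto
  then have "card S \<le> card {n. m < n \<and> n \<le> Max S \<and> cut m n x}"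
    by (intro card_mono) auto
  then show False using card_cut_le[OF x, of m "Max S"] S(2) by linarith
qed

lemma rank_le: "z \<in> X \<Longrightarrow> rank m (R (Suc m)) n z \<le> d (Suc m) + 2"
  using rank_le_card_cut[of n n m z] card_cut_le[of z "Suc m" n] by simp

lemma part_R_N: "part m (R (Suc m)) n x y \<Longrightarrow> N m (r m + b m) x y"
  using part_N rank_le .

section \<open>Bounded classes and finitely many separating indices\<close>

lemma R_bounded: "m \<le> n \<Longrightarrow> \<exists>t. \<forall>x y. R m n x y \<longrightarrow> N n t x y"
proof (induction "n - m" arbitrary: m)
  case 0
  then show ?case using N_refl by (auto simp: R_id)
next
  case (Suc k)
  then have mn: "m < n" and k: "k = n - Suc m" by auto
  obtain t where t: "\<And>x y. R (Suc m) n x y \<Longrightarrow> N n t x y" using Suc.hyps(1)[OF k] mn by auto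
  obtain t' where t': "\<And>x y. N m (r m + b m) x y \<Longrightarrow> N n t' x y" using iterate_control[of N m n, OF N_Suc] mn by force
  \<comment> \<open>A step moves \<open>y\<close> only within its part before
    \<open>R (Suc m)\<close> takes over, so each level adds a bounded amount, measured at level
    \<open>n\<close>.\<close>
  have "N n (t + t') x y" if xy: "R m n x y" for x y
  proof -
    have "step m (R (Suc m)) n x y" using xy R_step[OF mn] by simp
    then obtain y' where "part m (R (Suc m)) n y y'" "R (Suc m) n x y'"
      unfolding step_def using part_refl by blast
    then show ?thesis using N_trans[OF t N_sym[OF t'[OF part_R_N]]] by blast
  qed
  then show ?case by blast
qed

lemma finite_R: "finite {y. R 0 n x y}"
proof -
  obtain t where "\<And>x y. R 0 n x y \<Longrightarrow> N n t x y" using R_bounded[of 0 n] by auto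
  then have "{y. R 0 n x y} \<subseteq> {y. N n t x y}" by blast
  then show ?thesis using N_finite finite_subset by blast
qed

text \<open>The parts of two unrelated points contain points unrelated one level up. The drift from
  following such pairs through the levels below \<open>m\<close> is bounded by
  \<open>s m\<close>.\<close>

lemma R_lift:
  assumes s: "\<And>m x y. N m (s m + (r m + b m)) x y \<Longrightarrow> N (Suc m) (s (Suc m)) x y"
    and "\<not> R 0 n x y" "x \<in> X" "y \<in> X" "m \<le> n"
  shows "\<exists>u v. N m (s m) x u \<and> N m (s m) y v \<and> \<not> R m n u v"
  using assms(5)
proof (induction m)
  case 0
  then show ?case using assms(2-4) N_refl by blast
next
  case (Suc m)
  then obtain u v where uv: "N m (s m) x u" "N m (s m) y v" "\<not> R m n u v" by auto
  have mn: "m < n" using Suc.prems by simp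
  have X: "u \<in> X" "v \<in> X" using uv N_X N_sym by blast+
  obtain u' v' where u'v': "part m (R (Suc m)) n u u'" "part m (R (Suc m)) n v v'" "\<not> R (Suc m) n u' v'"
    using uv(3) X part_refl unfolding R_step[OF mn] step_def by blast
  then have "N (Suc m) (s (Suc m)) x u'" "N (Suc m) (s (Suc m)) y v'"
    using s N_trans[OF uv(1) part_R_N] N_trans[OF uv(2) part_R_N] by blast+
  then show ?case using u'v'(3) by blast
qed

text \<open>Once \<open>w m\<close> dominates distance plus drift, every index above
  \<open>m\<close> whose relation \<open>R 0 n\<close> separates \<open>x\<close> from
  \<open>y\<close> cuts at \<open>x\<close> on level \<open>m\<close>.\<close>

lemma finite_not_R:
  assumes s: "\<And>m x y. N m (s m + (r m + b m)) x y \<Longrightarrow> N (Suc m) (s (Suc m)) x y"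
    and xy: "N m t x y" and "t + s m \<le> w m"
  shows "finite {n. \<not> R 0 n x y}"
proof -
  have X: "x \<in> X" "y \<in> X" using xy N_X N_sym by blast+
  have "cut m n x" if n: "\<not> R 0 n x y" "m < n" for n
  proof -
    obtain u v where uv: "N m (s m) x u" "N m (s m) y v" "\<not> R m n u v"
      using R_lift[OF s n(1) X, of m] n(2) by auto
    have "N m (w m) x u" using N_mono[OF uv(1)] assms(3) by simp
    moreover have "N m (w m) x v" using N_trans_le[OF xy uv(2) assms(3)] .
    moreover have "\<not> R m n x u \<or> \<not> R m n x v" using uv(3) R_sym R_trans by blast
    ultimately show ?thesis unfolding cut_def by blast
  qed
  then have "{n. \<not> R 0 n x y} \<subseteq> {..m} \<union> {n. m < n \<and> cut m n x}" by force
  then show ?thesis using finite_cut[OF X(1), of m] finite_subset by blast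
qed

end


section \<open>Borelness and hyperfiniteness\<close>

locale borel_scales = scales "space M" N F d w b r
  for M :: "'a measure" and N :: "nat \<Rightarrow> nat \<Rightarrow> 'a \<Rightarrow> 'a \<Rightarrow> bool" and F :: "nat \<Rightarrow> 'a \<Rightarrow> 'a \<Rightarrow> bool"
    and d w b r :: "nat \<Rightarrow> nat" +
  fixes f :: "nat \<Rightarrow> 'a \<Rightarrow> 'a"
  assumes f_measurable: "f k \<in> M \<rightarrow>\<^sub>M M"
    and N_imp_f: "N m t x y \<Longrightarrow> \<exists>k. f k x = y"
    and N_zero: "N m 0 x y \<Longrightarrow> x = y"
    and N_borel: "Measurable.pred (M \<Otimes>\<^sub>M M) (\<lambda>p. N m t (fst p) (snd p))"
    and F_borel: "Measurable.pred (M \<Otimes>\<^sub>M M) (\<lambda>p. F m (fst p) (snd p))"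
begin

section \<open>Measurability of the construction\<close>

lemma pred_subst:
  assumes "Measurable.pred (M \<Otimes>\<^sub>M M) (\<lambda>p. P (fst p) (snd p))" "g \<in> A \<rightarrow>\<^sub>M M" "h \<in> A \<rightarrow>\<^sub>M M"
  shows "Measurable.pred A (\<lambda>a. P (g a) (h a))"
  using measurable_compose[OF measurable_Pair[OF assms(2,3)] assms(1)] by simp

lemma f_compose: "g \<in> A \<rightarrow>\<^sub>M M \<Longrightarrow> (\<lambda>a. f k (g a)) \<in> A \<rightarrow>\<^sub>M M"
  using measurable_compose f_measurable by blast

lemma fst_snd: "fst \<in> M \<Otimes>\<^sub>M M \<rightarrow>\<^sub>M M" "snd \<in> M \<Otimes>\<^sub>M M \<rightarrow>\<^sub>M M"
  by simp_all

lemma F_imp_f: "F m x y \<Longrightarrow> \<exists>k. f k x = y"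
  using F_N N_imp_f by blast

lemma near_borel: "Measurable.pred (M \<Otimes>\<^sub>M M) (\<lambda>p. near m t (fst p) (snd p))"
proof -
  have "near m t x z \<longleftrightarrow> (\<exists>k. F m z (f k z) \<and> N m t x (f k z))" for x z
    unfolding near_def using F_imp_f by metis
  then show ?thesis
    by (simp only:) (intro pred_intros_logic pred_intros_countable pred_subst[OF F_borel]
        pred_subst[OF N_borel] f_compose fst_snd)
qed

lemma active_borel:
  assumes "\<And>n. Measurable.pred (M \<Otimes>\<^sub>M M) (\<lambda>p. Q n (fst p) (snd p))"
  shows "Measurable.pred M (active m Q n)"
proof -
  let ?t = "2 * r m + 2 * b m + w m"
  have "active m Q n z \<longleftrightarrow> (\<exists>k i j. F m z (f k z) \<and> N m ?t (f k z) (f i (f k z)) \<and>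
      N m ?t (f k z) (f j (f k z)) \<and> \<not> Q n (f i (f k z)) (f j (f k z)))" for z
  proof
    assume "active m Q n z"
    then obtain z' u v where "F m z z'" "N m ?t z' u" "N m ?t z' v" "\<not> Q n u v"
      unfolding active_def by blast
    moreover from this obtain k i j where "f k z = z'" "f i z' = u" "f j z' = v"
      using F_imp_f[of m z z'] N_imp_f[of m ?t z' u] N_imp_f[of m ?t z' v] by blast
    ultimately show "\<exists>k i j. F m z (f k z) \<and> N m ?t (f k z) (f i (f k z)) \<and>
      N m ?t (f k z) (f j (f k z)) \<and> \<not> Q n (f i (f k z)) (f j (f k z))" by blast
  qed (auto simp: active_def)
  then have "active m Q n = (\<lambda>z. \<exists>k i j. F m z (f k z) \<and> N m ?t (f k z) (f i (f k z)) \<and>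
      N m ?t (f k z) (f j (f k z)) \<and> \<not> Q n (f i (f k z)) (f j (f k z)))" by (rule ext)
  then show ?thesis
    by (simp only:) (intro pred_intros_logic pred_intros_countable pred_subst[OF F_borel]
        pred_subst[OF N_borel] pred_subst[OF assms] f_compose measurable_ident_sets refl)
qed

text \<open>The radius varies with the cell through the rank. Fixing the finite set \<open>S\<close>
  of smaller active indices leaves a ball of constant radius.\<close>

lemma shell_borel:
  assumes "\<And>n. Measurable.pred (M \<Otimes>\<^sub>M M) (\<lambda>p. Q n (fst p) (snd p))"
  shows "Measurable.pred (M \<Otimes>\<^sub>M M) (\<lambda>p. shell m Q n (fst p) (snd p))"
proof -
  have "shell m Q n x z \<longleftrightarrow> (\<exists>S\<in>Pow {m<..<n}. (\<forall>n'\<in>{m<..<n}. active m Q n' z \<longleftrightarrow> n' \<in> S) \<and>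
      near m ((2 * card S + 1) * w m) x z)" for x z
  proof
    assume "shell m Q n x z"
    then show "\<exists>S\<in>Pow {m<..<n}. (\<forall>n'\<in>{m<..<n}. active m Q n' z \<longleftrightarrow> n' \<in> S) \<and>
        near m ((2 * card S + 1) * w m) x z"
      unfolding shell_def rank_def
      by (intro bexI[of _ "{n' \<in> {m<..<n}. active m Q n' z}"]) auto
  next
    assume "\<exists>S\<in>Pow {m<..<n}. (\<forall>n'\<in>{m<..<n}. active m Q n' z \<longleftrightarrow> n' \<in> S) \<and>
        near m ((2 * card S + 1) * w m) x z"
    then obtain S where S: "S \<subseteq> {m<..<n}" "\<forall>n'\<in>{m<..<n}. active m Q n' z \<longleftrightarrow> n' \<in> S"
      "near m ((2 * card S + 1) * w m) x z" by auto
    then have "S = {n' \<in> {m<..<n}. active m Q n' z}" by blast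
    then show "shell m Q n x z" using S(3) unfolding shell_def rank_def by simp
  qed
  moreover have "Measurable.pred (M \<Otimes>\<^sub>M M) (\<lambda>p. active m Q n' (snd p))" for n'
    by (rule measurable_compose[OF fst_snd(2) active_borel[OF assms]])
  ultimately show ?thesis
    by (simp only:) (intro pred_intros_finite pred_intros_logic near_borel; simp)
qed

text \<open>Only points \<open>z\<close> whose cell is reached from \<open>x\<close> or
  \<open>y\<close> can tell them apart, and \<open>f\<close> enumerates these; for all other
  \<open>z\<close> both sides of the equivalence are false.\<close>

lemma part_borel:
  assumes "\<And>n. Measurable.pred (M \<Otimes>\<^sub>M M) (\<lambda>p. Q n (fst p) (snd p))"
  shows "Measurable.pred (M \<Otimes>\<^sub>M M) (\<lambda>p. part m Q n (fst p) (snd p))"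
proof -
  have shell_f: "\<exists>k. f k x = z" if "shell m Q n x z" for x z
  proof -
    obtain z' t where "F m z z'" "N m t x z'" using \<open>shell m Q n x z\<close> unfolding shell_def near_def by blast
    then show ?thesis using N_imp_f[OF N_trans[OF _ F_N[OF F_sym]]] by blast
  qed
  have "part m Q n x y \<longleftrightarrow>
      (\<forall>k. shell m Q n x (f k x) \<longleftrightarrow> shell m Q n y (f k x)) \<and>
      (\<forall>k. shell m Q n x (f k y) \<longleftrightarrow> shell m Q n y (f k y))" if "x \<in> space M" "y \<in> space M" for x y
    unfolding part_def using that shell_f by metis
  then have "part m Q n (fst p) (snd p) \<longleftrightarrow>
      (\<forall>k. shell m Q n (fst p) (f k (fst p)) \<longleftrightarrow> shell m Q n (snd p) (f k (fst p))) \<and>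
      (\<forall>k. shell m Q n (fst p) (f k (snd p)) \<longleftrightarrow> shell m Q n (snd p) (f k (snd p)))"
    if "p \<in> space (M \<Otimes>\<^sub>M M)" for p
    using that by (auto simp: space_pair_measure)
  then show ?thesis
    by (subst measurable_cong, assumption) (intro pred_intros_logic pred_intros_countable
        pred_subst[OF shell_borel[OF assms]] f_compose fst_snd)
qed

lemma part_imp_f:
  assumes "part m Q n x y"
  shows "\<exists>k. f k x = y"
proof -
  have "shell m Q n x x"
    unfolding shell_def near_def using F_refl N_refl part_X[OF assms] by blast
  then have "shell m Q n y x" using assms unfolding part_def by blast
  then obtain z t where "F m x z" "N m t y z" unfolding shell_def near_def by blast
  then show ?thesis using N_imp_f[OF N_trans[OF F_N N_sym]] by blast
qed

lemma step_borel:
  assumes "\<And>n. Measurable.pred (M \<Otimes>\<^sub>M M) (\<lambda>p. Q n (fst p) (snd p))"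
  shows "Measurable.pred (M \<Otimes>\<^sub>M M) (\<lambda>p. step m Q n (fst p) (snd p))"
proof -
  have "step m Q n x y \<longleftrightarrow>
      (\<forall>k. part m Q n x (f k x) \<longrightarrow> (\<exists>j. part m Q n y (f j y) \<and> Q n (f k x) (f j y))) \<and>
      (\<forall>k. part m Q n y (f k y) \<longrightarrow> (\<exists>j. part m Q n x (f j x) \<and> Q n (f j x) (f k y)))"
    if "x \<in> space M" "y \<in> space M" for x y
  proof -
    have ex: "(\<exists>z. part m Q n a z \<and> P z) \<longleftrightarrow> (\<exists>k. part m Q n a (f k a) \<and> P (f k a))" for a P
      using part_imp_f by metis
    have all: "(\<forall>z. part m Q n a z \<longrightarrow> P z) \<longleftrightarrow> (\<forall>k. part m Q n a (f k a) \<longrightarrow> P (f k a))" for a P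
      using part_imp_f by metis
    show ?thesis unfolding step_def ex all using that by simp
  qed
  then have "step m Q n (fst p) (snd p) \<longleftrightarrow>
      (\<forall>k. part m Q n (fst p) (f k (fst p)) \<longrightarrow>
        (\<exists>j. part m Q n (snd p) (f j (snd p)) \<and> Q n (f k (fst p)) (f j (snd p)))) \<and>
      (\<forall>k. part m Q n (snd p) (f k (snd p)) \<longrightarrow>
        (\<exists>j. part m Q n (fst p) (f j (fst p)) \<and> Q n (f j (fst p)) (f k (snd p))))"
    if "p \<in> space (M \<Otimes>\<^sub>M M)" for p
    using that by (auto simp: space_pair_measure)
  then show ?thesis
    by (subst measurable_cong, assumption) (intro pred_intros_logic pred_intros_countable
        pred_subst[OF part_borel[OF assms]] pred_subst[OF assms] f_compose fst_snd)
qed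

lemma H_borel: "Measurable.pred (M \<Otimes>\<^sub>M M) (\<lambda>p. H K m n (fst p) (snd p))"
proof (induction K arbitrary: m n)
  case 0
  have "H 0 m n = N 0 0" using N_zero N_refl N_X by (intro ext) auto
  then show ?case using N_borel by simp
next
  case (Suc K)
  have "H 0 m n = N 0 0" using N_zero N_refl N_X by (intro ext) auto
  then show ?case using N_borel step_borel[OF Suc.IH] by (cases "n \<le> m") simp_all
qed

lemma R_borel: "Measurable.pred (M \<Otimes>\<^sub>M M) (\<lambda>p. R m n (fst p) (snd p))"
  unfolding R_def by (rule H_borel)

text \<open>\<open>exhaust\<close> brings every pair at finite distance to a level wide enough for
  \<open>finite_not_R\<close>; conversely \<open>R_bounded\<close> keeps the union inside the
  target.\<close>

lemma hyperfinite_union: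
  assumes s: "\<And>m x y. N m (s m + (r m + b m)) x y \<Longrightarrow> N (Suc m) (s (Suc m)) x y"
    and exhaust: "\<And>k t x y. N k t x y \<Longrightarrow> \<exists>m t'. N m t' x y \<and> t' + s m \<le> w m"
  shows "hyperfinite M {(x, y). \<exists>m t. N m t x y}"
proof -
  define Q where "Q n = {(x, y). x \<in> space M \<and> y \<in> space M \<and> (\<forall>n'\<ge>n. R 0 n' x y)}" for n
  have "finite_borel_equiv_rel M (Q n)" for n
    unfolding finite_borel_equiv_rel_def borel_equiv_rel_def
  proof (intro conjI ballI)
    show "equiv (space M) (Q n)"
      unfolding Q_def by (rule equivI) (auto intro!: refl_onI symI transI intro: R_refl R_sym R_trans)
    have "Q n = {p \<in> space (M \<Otimes>\<^sub>M M). \<forall>n'. n \<le> n' \<longrightarrow> R 0 n' (fst p) (snd p)}"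
      unfolding Q_def by (auto simp: space_pair_measure)
    also have "\<dots> \<in> sets (M \<Otimes>\<^sub>M M)"
      using R_borel[of 0] by (intro predE pred_intros_countable pred_intros_imp') auto
    finally show "Q n \<in> sets (M \<Otimes>\<^sub>M M)" .
    fix C assume "C \<in> space M // Q n"
    then obtain x where "C = Q n `` {x}" by (rule quotientE)
    then have "C \<subseteq> {y. R 0 n x y}" unfolding Q_def by auto
    then show "finite C" using finite_R finite_subset by blast
  qed
  moreover have "incseq Q"
    unfolding incseq_def Q_def by auto
  moreover have "{(x, y). \<exists>m t. N m t x y} = (\<Union>n. Q n)"
  proof (intro equalityI subsetI)
    fix p assume "p \<in> {(x, y). \<exists>m t. N m t x y}"
    then obtain x y k t where p: "p = (x, y)" "N k t x y" by blast
    have X: "x \<in> space M" "y \<in> space M" using p(2) N_X N_sym by blast+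
    obtain m t' where "N m t' x y" "t' + s m \<le> w m" using exhaust[OF p(2)] by blast
    then have "finite {n. \<not> R 0 n x y}" using finite_not_R[OF s] by blast
    then obtain n where "\<forall>i\<in>{n. \<not> R 0 n x y}. i < n" unfolding finite_nat_set_iff_bounded by blast
    then have "p \<in> Q n" unfolding Q_def p(1) using X by (auto simp: not_less[symmetric])
    then show "p \<in> (\<Union>n. Q n)" by blast
  next
    fix p assume "p \<in> (\<Union>n. Q n)"
    then obtain n x y where p: "p = (x, y)" "R 0 n x y" unfolding Q_def by auto
    obtain t where "\<And>x y. R 0 n x y \<Longrightarrow> N n t x y" using R_bounded[of 0 n] by auto
    then show "p \<in> {(x, y). \<exists>m t. N m t x y}" using p by blast
  qed
  ultimately show ?thesis unfolding hyperfinite_def by blast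
qed

end

section \<open>From extended metrics to scales\<close>

lemma le_of_nat_imp_ex:
  fixes D :: ennreal assumes "D < \<infinity>" shows "\<exists>k::nat. D \<le> of_nat k"
  using ennreal_Ex_less_of_nat[of D] assms by (auto intro: less_imp_le)

lemma borel_asdim_finite_imp_le:
  assumes "borel_asdim M \<rho> < \<infinity>"
  shows "\<exists>d. borel_asdim_le M \<rho> d"
proof (rule ccontr)
  assume "\<nexists>d. borel_asdim_le M \<rho> d"
  then have "borel_asdim M \<rho> = Inf {}" unfolding borel_asdim_def by simp
  then show False using assms by (simp add: Inf_enat_def)
qed

lemma ext_diameter_upper:
  "x \<in> A \<Longrightarrow> y \<in> A \<Longrightarrow> \<rho> x y \<le> ext_diameter \<rho> A"
  unfolding ext_diameter_def by (rule SUP_upper2, assumption, rule SUP_upper)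

theorem theorem1p10:
  fixes M :: "'a measure" and \<rho> :: "nat \<Rightarrow> 'a \<Rightarrow> 'a \<Rightarrow> ennreal"
  assumes "standard_borel M"
    and "\<And>n. borel_extended_metric M (\<rho> n)"
    and "\<And>n. proper_ext_metric_on (space M) (\<rho> n)"
    and "\<And>n r. r > 0 \<Longrightarrow>
           \<exists>D<\<infinity>. \<forall>x \<in> space M. ext_diameter (\<rho> (Suc n)) (ext_cball (space M) (\<rho> n) x r) \<le> D"
    and "\<And>n. borel_asdim M (\<rho> n) < \<infinity>"
  shows "hyperfinite M (\<Union>n. finite_dist_rel (space M) (\<rho> n))"
proof -
  define N where "N m t x y \<longleftrightarrow> x \<in> space M \<and> y \<in> space M \<and> \<rho> m x y \<le> of_nat t" for m t x y
  have metric: "\<rho> m x y = 0 \<longleftrightarrow> x = y" "\<rho> m x y = \<rho> m y x" "\<rho> m x z \<le> \<rho> m x y + \<rho> m y z"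
    if "x \<in> space M" "y \<in> space M" "z \<in> space M" for m x y z
    using assms(2)[of m] that unfolding borel_extended_metric_def extended_metric_on_def by blast+
  have N_refl: "N m t x x" if "x \<in> space M" for m t x
    unfolding N_def using that metric(1)[of x x x m] by simp
  have N_sym: "N m t y x" if "N m t x y" for m t x y
    using that metric(2)[of x y x m] unfolding N_def by simp
  have N_trans: "N m (s + t) x z" if xyz: "N m s x y" "N m t y z" for m s t x y z
  proof -
    have "\<rho> m x z \<le> \<rho> m x y + \<rho> m y z" using metric(3)[of x y z m] xyz unfolding N_def by simp
    also have "\<dots> \<le> of_nat s + of_nat t" using xyz unfolding N_def by (intro add_mono) auto
    finally show ?thesis using xyz unfolding N_def by simp
  qed
  have N_mono: "N m t x y" if "N m s x y" "s \<le> t" for m s t x y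
    using that order_trans[of "\<rho> m x y" "of_nat s" "of_nat t"] unfolding N_def by simp
  have N_X: "x \<in> space M" if "N m t x y" for m t x y
    using that unfolding N_def by simp
  have N_cball: "N m t x y \<longleftrightarrow> y \<in> ext_cball (space M) (\<rho> m) x (real t)" if "x \<in> space M" for m t x y
    unfolding N_def ext_cball_def using that by (simp add: ennreal_of_nat_eq_real_of_nat)
  have N_finite: "finite {y. N m t x y}" for m t x
  proof (cases "x \<in> space M")
    case True
    \<comment> \<open>\<open>Suc t\<close> instead of \<open>t\<close>, because properness speaks of
      positive radii only.\<close>
    have "finite (ext_cball (space M) (\<rho> m) x (real (Suc t)))"
      using assms(3)[of m] True unfolding proper_ext_metric_on_def by simp
    moreover have "{y. N m t x y} \<subseteq> ext_cball (space M) (\<rho> m) x (real (Suc t))"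
      using N_cball[OF True] N_mono[of m t x _ "Suc t"] by auto
    ultimately show ?thesis by (rule finite_subset[rotated])
  qed (simp add: N_def)
  have N_Suc: "\<exists>t'. \<forall>x y. N m t x y \<longrightarrow> N (Suc m) t' x y" for m t
  proof -
    obtain D where D: "D < \<infinity>"
      "\<And>x. x \<in> space M \<Longrightarrow> ext_diameter (\<rho> (Suc m)) (ext_cball (space M) (\<rho> m) x (real (Suc t))) \<le> D"
      using assms(4)[of "real (Suc t)" m] by auto
    obtain t' where t': "D \<le> of_nat t'" using le_of_nat_imp_ex[OF D(1)] by blast
    have "N (Suc m) t' x y" if xy: "N m t x y" for x y
    proof -
      have X: "x \<in> space M" "y \<in> space M" using xy unfolding N_def by auto
      have "x \<in> ext_cball (space M) (\<rho> m) x (real (Suc t))" "y \<in> ext_cball (space M) (\<rho> m) x (real (Suc t))"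
        using N_cball[OF X(1), of m "Suc t"] N_refl[OF X(1)] N_mono[OF xy, of "Suc t"] by auto
      then have "\<rho> (Suc m) x y \<le> D" using order_trans[OF ext_diameter_upper D(2)[OF X(1)]] by blast
      then show ?thesis using order_trans[OF _ t'] X unfolding N_def by blast
    qed
    then show ?thesis by blast
  qed
  have N_borel: "Measurable.pred (M \<Otimes>\<^sub>M M) (\<lambda>p. N m t (fst p) (snd p))" for m t
  proof -
    have [measurable]: "(\<lambda>(x, y). \<rho> m x y) \<in> borel_measurable (M \<Otimes>\<^sub>M M)"
      using assms(2)[of m] unfolding borel_extended_metric_def by blast
    have "Measurable.pred (M \<Otimes>\<^sub>M M) (\<lambda>p. (\<lambda>(x, y). \<rho> m x y) p \<le> of_nat t)" by measurable
    then show ?thesis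
      by (rule measurable_cong[THEN iffD1, rotated]) (auto simp: N_def space_pair_measure)
  qed
  have "\<exists>t'. \<forall>x y. N m t x y \<longrightarrow> N (Suc m) t' x y" for m t by (rule N_Suc)
  then obtain \<Phi> where \<Phi>: "\<And>m t x y. N m t x y \<Longrightarrow> N (Suc m) (\<Phi> m t) x y" by metis
  have "\<exists>B. \<forall>k m t x y. k \<le> m \<longrightarrow> N k t x y \<longrightarrow> N m (B k m t) x y"
  proof -
    have "\<forall>k m t. \<exists>t'. k \<le> m \<longrightarrow> (\<forall>x y. N k t x y \<longrightarrow> N m t' x y)"
      using iterate_control[of N, OF N_Suc] by blast
    then show ?thesis by metis
  qed
  then obtain B where B: "\<And>k m t x y. k \<le> m \<Longrightarrow> N k t x y \<Longrightarrow> N m (B k m t) x y" by blast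

  obtain d where d: "\<And>m. borel_asdim_le M (\<rho> m) (d m)"
    using borel_asdim_finite_imp_le[OF assms(5)] by metis
  define good where "good m t F b \<longleftrightarrow> borel_equiv_rel M F \<and> (\<forall>x y. (x, y) \<in> F \<longrightarrow> N m b x y) \<and>
      (\<forall>x\<in>space M. finite {C. \<exists>y. N m t x y \<and> C = {z. (y, z) \<in> F}} \<and>
        card {C. \<exists>y. N m t x y \<and> C = {z. (y, z) \<in> F}} \<le> d m + 1)" for m t F b
  have "\<exists>F b. good m t F b" if t: "t > 0" for m t
  proof -
    have "real t > 0" using t by simp
    from d[of m, unfolded borel_asdim_le_def, rule_format, OF this]
    obtain F D where F: "borel_equiv_rel M F" and D: "D < \<infinity>" "\<forall>C \<in> space M // F. ext_diameter (\<rho> m) C \<le> D"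
      and C: "\<forall>x \<in> space M. finite {C \<in> space M // F. C \<inter> ext_cball (space M) (\<rho> m) x (real t) \<noteq> {}} \<and>
                card {C \<in> space M // F. C \<inter> ext_cball (space M) (\<rho> m) x (real t) \<noteq> {}} \<le> d m + 1"
      by blast
    have eq: "equiv (space M) F" using F unfolding borel_equiv_rel_def by blast
    obtain b where b: "D \<le> of_nat b" using le_of_nat_imp_ex[OF D(1)] by blast
    have "N m b x y" if xy: "(x, y) \<in> F" for x y
    proof -
      have X: "x \<in> space M" "y \<in> space M" using eq xy by (auto simp: equiv_def refl_on_def)
      have "F `` {x} \<in> space M // F" "x \<in> F `` {x}" "y \<in> F `` {x}"
        using X xy equiv_class_self[OF eq] by (auto intro: quotientI)
      then have "\<rho> m x y \<le> D" using order_trans[OF ext_diameter_upper D(2)[rule_format]] by blast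
      then show ?thesis using order_trans[OF _ b] X unfolding N_def by blast
    qed
    moreover have "{C. \<exists>y. N m t x y \<and> C = {z. (y, z) \<in> F}} =
        {C \<in> space M // F. C \<inter> ext_cball (space M) (\<rho> m) x (real t) \<noteq> {}}" (is "?A = ?B") if x: "x \<in> space M" for x
    proof (intro equalityI subsetI)
      fix C assume "C \<in> ?A"
      then obtain y where y: "N m t x y" "C = F `` {y}" by (auto simp: Image_def)
      have "y \<in> space M" using y(1) unfolding N_def by simp
      then have "C \<in> space M // F" "y \<in> C" using y(2) equiv_class_self[OF eq] by (auto intro: quotientI)
      then show "C \<in> ?B" using N_cball[OF x] y(1) by blast
    next
      fix C assume "C \<in> ?B"
      then obtain y where y: "C \<in> space M // F" "y \<in> C" "N m t x y" using N_cball[OF x] by blast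
      obtain a where "a \<in> space M" "C = F `` {a}" using y(1) by (rule quotientE)
      then have "C = F `` {y}" using y(2) equiv_class_eq[OF eq] by blast
      then have "C = {z. (y, z) \<in> F}" by auto
      then show "C \<in> ?A" using y(3) by blast
    qed
    ultimately show ?thesis unfolding good_def using F C by (intro exI[of _ F] exI[of _ b]) simp
  qed
  then have "\<forall>m t. \<exists>F b. t > 0 \<longrightarrow> good m t F b" by blast
  then obtain F0 b0 where "\<forall>m t. t > 0 \<longrightarrow> good m t (F0 m t) (b0 m t)" by metis
  then have good: "good m t (F0 m t) (b0 m t)" if "t > 0" for m t using that by blast
  have F0: "borel_equiv_rel M (F0 m t)" "(x, y) \<in> F0 m t \<Longrightarrow> N m (b0 m t) x y"
      "x \<in> space M \<Longrightarrow> finite {C. \<exists>y. N m t x y \<and> C = {z. (y, z) \<in> F0 m t}} \<and>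
        card {C. \<exists>y. N m t x y \<and> C = {z. (y, z) \<in> F0 m t}} \<le> d m + 1" if "t > 0" for m t x y
    using good[OF that, of m] unfolding good_def by blast+

  define rr where "rr m v = (2 * (d (Suc m) + 2) + 2) * v" for m v :: nat
  \<comment> \<open>\<open>w\<close> and \<open>s\<close> are defined together, because the
    partition and its bound \<open>b0\<close> can be chosen only after the radius obtained from
    \<open>w m\<close>. In the new width the first summand yields \<open>expand\<close>, the second
    absorbs the drift, the sum admits all pairs at distance at most \<open>Suc m\<close> in some
    metric of level \<open>k \<le> Suc m\<close>, and \<open>1\<close> keeps the radii
    positive.\<close>
  define ws where "ws = rec_nat (1, 0) (\<lambda>m (v, s).
     let s' = \<Phi> m (s + (rr m v + b0 m (rr m v))) in
     (\<Phi> m (2 * rr m v + 3 * b0 m (rr m v) + v) + s' + (\<Sum>k\<le>Suc m. B k (Suc m) (Suc m)) + 1, s'))"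
  define w where "w m = fst (ws m)" for m
  define s where "s m = snd (ws m)" for m
  define r where "r m = rr m (w m)" for m
  define b where "b m = b0 m (r m)" for m
  define F where "F m x y \<longleftrightarrow> (x, y) \<in> F0 m (r m)" for m x y
  have s_Suc: "s (Suc m) = \<Phi> m (s m + (r m + b m))" for m
    unfolding s_def r_def b_def w_def ws_def by (simp add: case_prod_unfold Let_def)
  have w_Suc: "w (Suc m) = \<Phi> m (2 * r m + 3 * b m + w m) + s (Suc m) + (\<Sum>k\<le>Suc m. B k (Suc m) (Suc m)) + 1" for m
    unfolding s_def r_def b_def w_def ws_def by (simp add: case_prod_unfold Let_def)
  have w_pos: "w m > 0" for m by (cases m) (simp_all add: w_Suc, simp add: w_def ws_def)
  have r_pos: "r m > 0" for m unfolding r_def rr_def using w_pos by simp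
  have F_equiv: "equiv (space M) (F0 m (r m))" for m
    using F0(1)[OF r_pos] unfolding borel_equiv_rel_def by blast

  have "\<exists>f :: nat \<Rightarrow> 'a \<Rightarrow> 'a. (\<forall>k. f k \<in> M \<rightarrow>\<^sub>M M) \<and> (\<forall>x y. N m t x y \<longrightarrow> (\<exists>k. f k x = y))" for m t
  proof -
    have "{p \<in> space (M \<Otimes>\<^sub>M M). N m t (fst p) (snd p)} \<in> sets (M \<Otimes>\<^sub>M M)"
      using N_borel by (rule predE)
    moreover have "{p \<in> space (M \<Otimes>\<^sub>M M). N m t (fst p) (snd p)} = {(x, y). N m t x y}"
      unfolding N_def by (auto simp: space_pair_measure)
    ultimately show ?thesis
      using ex_measurable_selectors[OF assms(1), of "{(x, y). N m t x y}"] N_finite by simp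
  qed
  then obtain g :: "nat \<Rightarrow> nat \<Rightarrow> nat \<Rightarrow> 'a \<Rightarrow> 'a" where g: "\<And>m t k. g m t k \<in> M \<rightarrow>\<^sub>M M"
    "\<And>m t x y. N m t x y \<Longrightarrow> \<exists>k. g m t k x = y" by metis
  define f where "f i = (case from_nat i of (m, t, k) \<Rightarrow> g m t k)" for i

  interpret borel_scales M N F d w b r f
  proof
    fix m u t x y z
    show "x \<in> space M \<Longrightarrow> N m t x x" by (rule N_refl)
    show "N m t x y \<Longrightarrow> N m t y x" by (rule N_sym)
    show "N m u x y \<Longrightarrow> N m t y z \<Longrightarrow> N m (u + t) x z" by (rule N_trans)
    show "N m u x y \<Longrightarrow> u \<le> t \<Longrightarrow> N m t x y" by (rule N_mono)
    show "N m t x y \<Longrightarrow> x \<in> space M" by (rule N_X)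
    show "finite {y. N m t x y}" by (rule N_finite)
    show "\<exists>t'. \<forall>x y. N m t x y \<longrightarrow> N (Suc m) t' x y" by (rule N_Suc)
    show "x \<in> space M \<Longrightarrow> F m x x"
      unfolding F_def using equiv_class_self[OF F_equiv] by blast
    show "F m x y \<Longrightarrow> F m y x"
      unfolding F_def using equivE[OF F_equiv[of m]] by (auto dest: symD)
    show "F m x y \<Longrightarrow> F m y z \<Longrightarrow> F m x z"
      unfolding F_def using equivE[OF F_equiv[of m]] by (auto dest: transD)
    show "F m x y \<Longrightarrow> N m (b m) x y"
      unfolding F_def b_def using F0(2)[OF r_pos] .
    show "x \<in> space M \<Longrightarrow> finite {C. \<exists>y. N m (r m) x y \<and> C = {z. F m y z}}"
      "x \<in> space M \<Longrightarrow> card {C. \<exists>y. N m (r m) x y \<and> C = {z. F m y z}} \<le> d m + 1"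
      unfolding F_def using F0(3)[OF r_pos] by blast+
    show "r m = (2 * (d (Suc m) + 2) + 2) * w m" unfolding r_def rr_def ..
    show "N m (2 * r m + 3 * b m + w m) x y \<Longrightarrow> N (Suc m) (w (Suc m)) x y"
      by (rule N_mono[OF \<Phi>], assumption) (unfold w_Suc, linarith)
    show "f i \<in> M \<rightarrow>\<^sub>M M" for i
      unfolding f_def using g(1) by (auto split: prod.split)
    show "\<exists>i. f i x = y" if xy: "N m t x y"
    proof -
      obtain k where "g m t k x = y" using g(2)[OF xy] by blast
      then have "f (to_nat (m, t, k)) x = y" unfolding f_def by simp
      then show ?thesis ..
    qed
    show "N m 0 x y \<Longrightarrow> x = y" unfolding N_def using metric(1)[of x y x m] by simp
    show "Measurable.pred (M \<Otimes>\<^sub>M M) (\<lambda>p. N m t (fst p) (snd p))" by (rule N_borel)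
    have "F0 m (r m) \<in> sets (M \<Otimes>\<^sub>M M)" using F0(1)[OF r_pos] unfolding borel_equiv_rel_def by blast
    then show "Measurable.pred (M \<Otimes>\<^sub>M M) (\<lambda>p. F m (fst p) (snd p))"
      unfolding F_def prod.collapse by (rule pred_sets2) simp
  qed
  have "hyperfinite M {(x, y). \<exists>m t. N m t x y}"
  proof (rule hyperfinite_union)
    show "N m (s m + (r m + b m)) x y \<Longrightarrow> N (Suc m) (s (Suc m)) x y" for m x y
      unfolding s_Suc by (rule \<Phi>)
    show "\<exists>m t'. N m t' x y \<and> t' + s m \<le> w m" if xy: "N k t x y" for k t x y
    proof -
      \<comment> \<open>Then \<open>k\<close> and \<open>t\<close> are both at most
        \<open>Suc m\<close>, so the sum in \<open>w (Suc m)\<close> covers this pair.\<close>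
      define m where "m = k + t"
      have "N k (Suc m) x y" by (rule N_mono[OF xy]) (simp add: m_def)
      then have "N (Suc m) (B k (Suc m) (Suc m)) x y" by (intro B) (simp_all add: m_def)
      moreover have "B k (Suc m) (Suc m) \<le> (\<Sum>k\<le>Suc m. B k (Suc m) (Suc m))"
        by (rule member_le_sum) (simp_all add: m_def)
      then have "B k (Suc m) (Suc m) + s (Suc m) \<le> w (Suc m)" unfolding w_Suc by simp
      ultimately show ?thesis by blast
    qed
  qed
  also have "{(x, y). \<exists>m t. N m t x y} = (\<Union>n. finite_dist_rel (space M) (\<rho> n))"
  proof (intro equalityI subsetI)
    fix p assume "p \<in> {(x, y). \<exists>m t. N m t x y}"
    then obtain x y m t where "p = (x, y)" "N m t x y" by blast
    then have "p \<in> finite_dist_rel (space M) (\<rho> m)"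
      unfolding N_def finite_dist_rel_def using le_less_trans[OF _ of_nat_less_top] by auto
    then show "p \<in> (\<Union>n. finite_dist_rel (space M) (\<rho> n))" by blast
  next
    fix p assume "p \<in> (\<Union>n. finite_dist_rel (space M) (\<rho> n))"
    then obtain x y n where "p = (x, y)" "x \<in> space M" "y \<in> space M" "\<rho> n x y < \<infinity>"
      unfolding finite_dist_rel_def by blast
    then show "p \<in> {(x, y). \<exists>m t. N m t x y}" using le_of_nat_imp_ex[of "\<rho> n x y"] unfolding N_def by blast
  qed
  finally show ?thesis .
qed

end
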